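(* Let $A$ be a pro-$p$ ring and $G$ a closed subgroup of $\mathrm{GL}_n(A)$. If $G$ contains a dense subset consisting of torsion elements, then $G$ contains a solvable subgroup of finite index.
   Context: A pro-$p$ ring is a commutative Noetherian complete local ring with finite residue field of characteristic $p$. *)

theory Defs
  imports
    "HOL-Algebra.Ring_Divisibility"
    "HOL-Algebra.Ideal_Product"
    "HOL-Algebra.QuotRing"
    "HOL-Algebra.Solvable_Groups"
    "HOL-Analysis.Function_Topology"
    "Jordan_Normal_Form.Matrix"
    "Jordan_Normal_Form.VS_Connect"
begin

section \<open>Pro-p rings\<close>

primrec ideal_power :: "('a, 'b) ring_scheme \<Rightarrow> 'a set \<Rightarrow> nat \<Rightarrow> 'a set" where
  "ideal_power R I 0 = carrier R"
| "ideal_power R I (Suc k) = ideal_prod R I (ideal_power R I k)"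

definition local_ring :: "('a, 'b) ring_scheme \<Rightarrow> bool" where
  "local_ring R \<longleftrightarrow> cring R \<and> (\<exists>!M. maximalideal M R)"

definition max_ideal :: "('a, 'b) ring_scheme \<Rightarrow> 'a set" where
  "max_ideal R = (THE M. maximalideal M R)"

text \<open>Completeness means that the canonical map from \<open>R\<close> to the inverse limit of the quotients
  \<open>R / I ^ k\<close> is bijective. An element of the inverse limit is given by a sequence of
  representatives \<open>s k\<close> that is compatible modulo \<open>I ^ k\<close>; existence of the limit is
  surjectivity, uniqueness is injectivity (so completeness includes separatedness).\<close>

definition adically_complete :: "('a, 'b) ring_scheme \<Rightarrow> 'a set \<Rightarrow> bool" where
  "adically_complete R I \<longleftrightarrow>
    (\<forall>s :: nat \<Rightarrow> 'a.
      (\<forall>k. s k \<in> carrier R) \<and> (\<forall>k. s (Suc k) \<ominus>\<^bsub>R\<^esub> s k \<in> ideal_power R I k) \<longrightarrow>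
      (\<exists>!x. x \<in> carrier R \<and> (\<forall>k. x \<ominus>\<^bsub>R\<^esub> s k \<in> ideal_power R I k)))"

definition has_characteristic :: "('a, 'b) ring_scheme \<Rightarrow> nat \<Rightarrow> bool" where
  "has_characteristic R p \<longleftrightarrow> (\<forall>k::nat. [k] \<cdot>\<^bsub>R\<^esub> \<one>\<^bsub>R\<^esub> = \<zero>\<^bsub>R\<^esub> \<longleftrightarrow> p dvd k)"

text \<open>The number \<open>p\<close> is automatically prime, being the characteristic of a finite field.\<close>

definition pro_p_ring :: "('a, 'b) ring_scheme \<Rightarrow> nat \<Rightarrow> bool" where
  "pro_p_ring R p \<longleftrightarrow>
    local_ring R \<and>
    noetherian_ring R \<and>
    adically_complete R (max_ideal R) \<and>
    finite (carrier (R Quot max_ideal R)) \<and>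
    has_characteristic (R Quot max_ideal R) p"

section \<open>The adic topology\<close>

definition adic_topology :: "('a, 'b) ring_scheme \<Rightarrow> 'a set \<Rightarrow> 'a topology" where
  "adic_topology R I = topology (\<lambda>U. U \<subseteq> carrier R \<and>
    (\<forall>x\<in>U. \<exists>k. \<forall>y\<in>carrier R. y \<ominus>\<^bsub>R\<^esub> x \<in> ideal_power R I k \<longrightarrow> y \<in> U))"

lemma ideal_ideal_power:
  assumes "ring R" "ideal I R"
  shows "ideal (ideal_power R I k) R"
  using assms by (induction k) (auto simp: ring.oneideal ring.ideal_prod_is_ideal)

lemma ideal_power_antimono:
  assumes "ring R" "ideal I R" "j \<le> k"
  shows "ideal_power R I k \<subseteq> ideal_power R I j"
  using assms(3)
proof (induction rule: dec_induct)
  case (step k)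
  have "ideal_power R I (Suc k) \<subseteq> ideal_power R I k"
    using ring.ideal_prod_inter[OF assms(1,2) ideal_ideal_power[OF assms(1,2)]] by auto
  with step show ?case by blast
qed simp

lemma openin_adic_topology:
  assumes "ring R" "ideal I R"
  shows "openin (adic_topology R I) U \<longleftrightarrow> U \<subseteq> carrier R \<and>
    (\<forall>x\<in>U. \<exists>k. \<forall>y\<in>carrier R. y \<ominus>\<^bsub>R\<^esub> x \<in> ideal_power R I k \<longrightarrow> y \<in> U)"
proof -
  let ?L = "\<lambda>U. U \<subseteq> carrier R \<and>
    (\<forall>x\<in>U. \<exists>k. \<forall>y\<in>carrier R. y \<ominus>\<^bsub>R\<^esub> x \<in> ideal_power R I k \<longrightarrow> y \<in> U)"
  have "istopology ?L"
    unfolding istopology_def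
  proof (intro conjI allI impI)
    fix S T assume S: "?L S" and T: "?L T"
    show "S \<inter> T \<subseteq> carrier R" using S by blast
    show "\<forall>x\<in>S \<inter> T. \<exists>k. \<forall>y\<in>carrier R. y \<ominus>\<^bsub>R\<^esub> x \<in> ideal_power R I k \<longrightarrow> y \<in> S \<inter> T"
    proof
      fix x assume x: "x \<in> S \<inter> T"
      obtain i where i: "\<forall>y\<in>carrier R. y \<ominus>\<^bsub>R\<^esub> x \<in> ideal_power R I i \<longrightarrow> y \<in> S"
        using S x by blast
      obtain j where j: "\<forall>y\<in>carrier R. y \<ominus>\<^bsub>R\<^esub> x \<in> ideal_power R I j \<longrightarrow> y \<in> T"
        using T x by blast
      have "ideal_power R I (max i j) \<subseteq> ideal_power R I i \<inter> ideal_power R I j"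
        using ideal_power_antimono[OF assms] by simp
      with i j show "\<exists>k. \<forall>y\<in>carrier R. y \<ominus>\<^bsub>R\<^esub> x \<in> ideal_power R I k \<longrightarrow> y \<in> S \<inter> T"
        by blast
    qed
  next
    fix \<K> assume K: "\<forall>K\<in>\<K>. ?L K"
    show "\<Union>\<K> \<subseteq> carrier R" using K by blast
    show "\<forall>x\<in>\<Union>\<K>. \<exists>k. \<forall>y\<in>carrier R. y \<ominus>\<^bsub>R\<^esub> x \<in> ideal_power R I k \<longrightarrow> y \<in> \<Union>\<K>"
      using K by (meson UnionE UnionI)
  qed
  then show ?thesis
    unfolding adic_topology_def by simp
qed

section \<open>The general linear group as a topological group\<close>

definition GL :: "nat \<Rightarrow> 'a :: comm_ring_1 mat monoid" where
  "GL n = units_of (ring_mat TYPE('a) n ())"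

text \<open>The topology on square matrices given by a topology \<open>T\<close> on the coefficients is the product
  topology on the \<open>n\<^sup>2\<close> entries.\<close>

definition mat_topology :: "'a topology \<Rightarrow> nat \<Rightarrow> 'a mat topology" where
  "mat_topology T n = pullback_topology (carrier_mat n n)
     (\<lambda>M. \<lambda>ij\<in>{..<n} \<times> {..<n}. M $$ ij) (product_topology (\<lambda>_. T) ({..<n} \<times> {..<n}))"

text \<open>Since inversion is continuous on the units of a complete local ring, no separate condition
  on the inverse matrix is needed in the topology of the general linear group.\<close>

definition GL_topology :: "nat \<Rightarrow> 'a :: comm_ring_1 mat topology" where
  "GL_topology n = subtopology
     (mat_topology (adic_topology class_ring (max_ideal class_ring)) n) (carrier (GL n))"

definition torsion_element :: "('a, 'b) monoid_scheme \<Rightarrow> 'a \<Rightarrow> bool" where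
  "torsion_element G g \<longleftrightarrow> g \<in> carrier G \<and> (\<exists>k::nat. k > 0 \<and> g [^]\<^bsub>G\<^esub> k = \<one>\<^bsub>G\<^esub>)"

end

theory Submission
  imports Defs "Jordan_Normal_Form.Determinant"
begin

text \<open>Let \<open>U\<^sub>j\<close> be the group of matrices in \<open>G\<close> congruent to the identity modulo the \<open>j\<close>-th power of the
  maximal ideal; it has finite index. Call an ideal \<open>I\<close> good if some derived subgroup of some \<open>U\<^sub>j\<close> is
  trivial modulo \<open>I\<close>. If \<open>I\<^sub>1\<close> and \<open>I\<^sub>2\<close> are good and \<open>I\<close> contains their product, then \<open>I\<close> is good,
  because commutators of matrices that are trivial modulo \<open>I\<^sub>1\<close> and \<open>I\<^sub>2\<close> are trivial modulo \<open>I\<close>. By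
  Noetherian induction it suffices that every prime \<open>P\<close> is good; then \<open>0\<close> is good, which is the claim.

  If \<open>p\<close> is not in \<open>P\<close>, torsion elements of \<open>U\<^sub>j\<close> are trivial modulo \<open>P\<close> for large \<open>j\<close>, and since \<open>P\<close> is
  closed (by compactness) all of \<open>U\<^sub>j\<close> is. If \<open>p \<in> P\<close>, torsion elements \<open>g\<close> of \<open>U\<^sub>1\<close> are of \<open>p\<close>-power
  order modulo \<open>P\<close>, so that \<open>det (1 - a g) = (1 - a)\<^sup>n\<close> modulo \<open>P\<close>, and by density this holds on \<open>U\<^sub>1\<close>.
  Writing \<open>1 - a g - S = (1 - a g) (1 - (1 - a g)\<^sup>-\<^sup>1 S)\<close> and expanding the inverse, one eliminates the
  terms of a linear combination in order of increasing adic valuation; hence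
  \<open>det (1 - \<Sum> a\<^sub>i g\<^sub>i) = (1 - \<Sum> a\<^sub>i)\<^sup>n\<close> for all \<open>a\<^sub>i\<close> in the maximal ideal. So every element of the span of
  the \<open>g - 1\<close> has only the eigenvalue \<open>0\<close> modulo \<open>P\<close>, which makes any product of \<open>n\<close> factors \<open>g\<^sub>i - 1\<close>
  vanish modulo \<open>P\<close>, and \<open>U\<^sub>1\<close> is solvable modulo \<open>P\<close>.\<close>

section \<open>Ideals\<close>

text \<open>Ideals as subsets of a type with commutative ring operations.
  \<open>ideal_class_ring_iff\<close> identifies them with the ideals of \<open>class_ring\<close>,
  so that the whole argument can use type class arithmetic.\<close>

definition ring_ideal :: "'a::comm_ring_1 set \<Rightarrow> bool" where
  "ring_ideal I \<longleftrightarrow> 0 \<in> I \<and> (\<forall>x\<in>I. \<forall>y\<in>I. x + y \<in> I) \<and> (\<forall>a. \<forall>x\<in>I. a * x \<in> I)"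

lemma ring_ideal_0: "ring_ideal I \<Longrightarrow> 0 \<in> I"
  and ring_ideal_add: "ring_ideal I \<Longrightarrow> x \<in> I \<Longrightarrow> y \<in> I \<Longrightarrow> x + y \<in> I"
  and ring_ideal_mult_left: "ring_ideal I \<Longrightarrow> x \<in> I \<Longrightarrow> a * x \<in> I"
  by (auto simp: ring_ideal_def)

lemma ring_ideal_mult_right: "ring_ideal I \<Longrightarrow> x \<in> I \<Longrightarrow> x * a \<in> I"
  using ring_ideal_mult_left[of I x a] by (simp add: mult.commute)

lemma ring_ideal_uminus: "ring_ideal I \<Longrightarrow> x \<in> I \<Longrightarrow> - x \<in> I"
  using ring_ideal_mult_left[of I x "-1"] by simp

lemma ring_ideal_minus: "ring_ideal I \<Longrightarrow> x \<in> I \<Longrightarrow> y \<in> I \<Longrightarrow> x - y \<in> I"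
  using ring_ideal_add[of I x "-y"] ring_ideal_uminus[of I y] by simp

lemma ring_ideal_minus_commute: "ring_ideal I \<Longrightarrow> x - y \<in> I \<Longrightarrow> y - x \<in> I"
  using ring_ideal_uminus[of I "x - y"] by simp

lemma ring_ideal_minus_trans: "ring_ideal I \<Longrightarrow> x - y \<in> I \<Longrightarrow> y - z \<in> I \<Longrightarrow> x - z \<in> I"
  using ring_ideal_add[of I "x - y" "y - z"] by simp

lemma ring_ideal_mem_cong: "ring_ideal I \<Longrightarrow> x - y \<in> I \<Longrightarrow> x \<in> I \<longleftrightarrow> y \<in> I"
  using ring_ideal_minus[of I x "x - y"] ring_ideal_add[of I y "x - y"] by auto

lemma ring_ideal_sum: "ring_ideal I \<Longrightarrow> (\<And>x. x \<in> A \<Longrightarrow> f x \<in> I) \<Longrightarrow> sum f A \<in> I"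
  by (induction A rule: infinite_finite_induct) (auto intro: ring_ideal_0 ring_ideal_add)

lemma ring_ideal_mult_cong:
  assumes "ring_ideal I" "a - b \<in> I" "c - d \<in> I"
  shows "a * c - b * d \<in> I"
proof -
  have "a * c - b * d = (a - b) * c + b * (c - d)" by (simp add: algebra_simps)
  with assms show ?thesis
    by (simp add: ring_ideal_add ring_ideal_mult_left ring_ideal_mult_right)
qed

lemma ring_ideal_prod_cong:
  assumes "ring_ideal I" "\<And>x. x \<in> A \<Longrightarrow> f x - g x \<in> I"
  shows "prod f A - prod g A \<in> I"
  using assms(2)
  by (induction A rule: infinite_finite_induct)
    (auto intro: ring_ideal_0[OF assms(1)] ring_ideal_mult_cong[OF assms(1)])

lemma ring_ideal_power_cong:
  assumes "ring_ideal I" "x - y \<in> I"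
  shows "x ^ k - y ^ k \<in> I"
  using ring_ideal_prod_cong[OF assms(1), of "{..<k}" "\<lambda>_. x" "\<lambda>_. y"] assms(2) by simp

lemma ring_ideal_UNIV_iff: "ring_ideal I \<Longrightarrow> I = UNIV \<longleftrightarrow> 1 \<in> I"
  using ring_ideal_mult_left[of I 1] by auto

section \<open>Sums of ideals and generated ideals\<close>

definition ideal_add :: "'a::comm_ring_1 set \<Rightarrow> 'a set \<Rightarrow> 'a set" where
  "ideal_add I J = {x + y | x y. x \<in> I \<and> y \<in> J}"

lemma ideal_addI: "x \<in> I \<Longrightarrow> y \<in> J \<Longrightarrow> x + y \<in> ideal_add I J"
  by (auto simp: ideal_add_def)

text \<open>With \<open>J = M k\<close> this is how closures are handled: \<open>z\<close> lies in
  the sum as soon as some element of \<open>I\<close> agrees with it modulo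
  \<open>M k\<close>.\<close>

lemma ideal_add_minusI: "ring_ideal J \<Longrightarrow> x \<in> I \<Longrightarrow> z - x \<in> J \<Longrightarrow> z \<in> ideal_add I J"
  using ideal_addI[of x I "z - x" J] by simp

lemma ring_ideal_ideal_add:
  assumes "ring_ideal I" "ring_ideal J"
  shows "ring_ideal (ideal_add I J)"
  unfolding ring_ideal_def
proof (intro conjI ballI allI)
  show "0 \<in> ideal_add I J"
    using ideal_addI[OF ring_ideal_0[OF assms(1)] ring_ideal_0[OF assms(2)]] by simp
next
  fix x y assume "x \<in> ideal_add I J" "y \<in> ideal_add I J"
  then obtain a b c d where "x = a + b" "y = c + d" "a \<in> I" "b \<in> J" "c \<in> I" "d \<in> J"
    by (auto simp: ideal_add_def)
  then show "x + y \<in> ideal_add I J"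
    using ideal_addI[of "a + c" I "b + d" J] assms by (simp add: ring_ideal_add algebra_simps)
next
  fix a x assume "x \<in> ideal_add I J"
  then obtain b c where "x = b + c" "b \<in> I" "c \<in> J" by (auto simp: ideal_add_def)
  then show "a * x \<in> ideal_add I J"
    using ideal_addI[of "a * b" I "a * c" J] assms
    by (simp add: ring_ideal_mult_left algebra_simps)
qed

lemma ideal_add_left: "ring_ideal J \<Longrightarrow> x \<in> I \<Longrightarrow> x \<in> ideal_add I J"
  using ideal_addI[of x I 0 J] by (simp add: ring_ideal_0)

lemma ideal_add_right: "ring_ideal I \<Longrightarrow> x \<in> J \<Longrightarrow> x \<in> ideal_add I J"
  using ideal_addI[of 0 I x J] by (simp add: ring_ideal_0)

definition ideal_gen :: "'a::comm_ring_1 set \<Rightarrow> 'a set" where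
  "ideal_gen A = \<Inter>{I. ring_ideal I \<and> A \<subseteq> I}"

lemma ring_ideal_ideal_gen: "ring_ideal (ideal_gen A)"
  by (auto simp: ideal_gen_def ring_ideal_def)

lemma ideal_gen_incl: "A \<subseteq> ideal_gen A"
  by (auto simp: ideal_gen_def)

lemma ideal_gen_minimal: "ring_ideal I \<Longrightarrow> A \<subseteq> I \<Longrightarrow> ideal_gen A \<subseteq> I"
  by (auto simp: ideal_gen_def)

lemma ring_ideal_zero: "ring_ideal {0}"
  by (auto simp: ring_ideal_def)

lemma ideal_gen_empty: "ideal_gen {} = {0}"
  using ideal_gen_minimal[OF ring_ideal_zero, of "{}"] ring_ideal_0[OF ring_ideal_ideal_gen, of "{}"]
  by auto

lemma ring_ideal_principal: "ring_ideal {r * b | r. True}"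
  unfolding ring_ideal_def
proof (intro conjI ballI allI)
  show "0 \<in> {r * b | r. True}" by (auto intro!: exI[of _ 0])
next
  fix x y assume "x \<in> {r * b | r. True}" "y \<in> {r * b | r. True}"
  then obtain r s where "x + y = (r + s) * b" by (auto simp: algebra_simps)
  then show "x + y \<in> {r * b | r. True}" by blast
next
  fix a x assume "x \<in> {r * b | r. True}"
  then obtain r where "x = r * b" by blast
  then have "a * x = (a * r) * b" by (simp add: algebra_simps)
  then show "a * x \<in> {r * b | r. True}" by blast
qed

text \<open>The sum of \<open>ideal_gen A\<close> and the multiples of \<open>b\<close> is an ideal
  that contains all generators. This drives the inductions that add one generator at a time.\<close>

lemma ideal_gen_insertE:
  assumes "x \<in> ideal_gen (insert b A)"
  obtains y r where "y \<in> ideal_gen A" "x = y + r * b"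
proof -
  let ?J = "ideal_add (ideal_gen A) {r * b | r. True}"
  have J: "ring_ideal ?J"
    by (intro ring_ideal_ideal_add ring_ideal_ideal_gen ring_ideal_principal)
  have "b \<in> {r * b | r. True}" by (auto intro!: exI[of _ 1])
  then have "insert b A \<subseteq> ?J"
    using ideal_gen_incl[of A] ideal_add_left[OF ring_ideal_principal, of _ "ideal_gen A" b]
      ideal_add_right[OF ring_ideal_ideal_gen[of A], of b] by auto
  then have "x \<in> ?J" using ideal_gen_minimal[OF J] assms by blast
  then show ?thesis using that by (auto simp: ideal_add_def)
qed

section \<open>Complete local rings with finite residue field\<close>

text \<open>Abstracts a Noetherian local ring that is complete with finite residue field; \<open>M k\<close> is the
  \<open>k\<close>-th power of the maximal ideal.\<close>

locale complete_local =
  fixes M :: "nat \<Rightarrow> 'a::comm_ring_1 set" and p :: nat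
  assumes M_ideal: "ring_ideal (M k)"
    and M_0: "M 0 = UNIV"
    and M_mult: "x \<in> M i \<Longrightarrow> y \<in> M j \<Longrightarrow> x * y \<in> M (i + j)"
    and M_Suc: "M (Suc k) \<subseteq> M k"
    and one_notin: "1 \<notin> M 1"
    and maximal: "x \<notin> M 1 \<Longrightarrow> \<exists>a. 1 - a * x \<in> M 1"
    and complete: "(\<And>k. s (Suc k) - s k \<in> M k) \<Longrightarrow> \<exists>x. \<forall>k. x - s k \<in> M k"
    and separated: "(\<And>k. x \<in> M k) \<Longrightarrow> x = 0"
    and noetherian: "ring_ideal (I :: 'a set) \<Longrightarrow> \<exists>A. finite A \<and> I = ideal_gen A"
    and finite_residue: "\<exists>R. finite R \<and> (\<forall>x. \<exists>r\<in>R. x - r \<in> M 1)"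
    and characteristic: "of_nat k \<in> M 1 \<longleftrightarrow> p dvd k"
begin

lemma M_antimono: "i \<le> j \<Longrightarrow> M j \<subseteq> M i"
  by (rule lift_Suc_antimono_le[of M]) (use M_Suc in auto)

lemma M1_prime: "x * y \<in> M 1 \<Longrightarrow> x \<in> M 1 \<or> y \<in> M 1"
proof (rule ccontr)
  assume xy: "x * y \<in> M 1" and "\<not> (x \<in> M 1 \<or> y \<in> M 1)"
  then obtain a b where ab: "1 - a * x \<in> M 1" "1 - b * y \<in> M 1" using maximal by blast
  have "1 = (1 - a * x) + a * x * (1 - b * y) + (a * b) * (x * y)" by (simp add: algebra_simps)
  with ab xy have "1 \<in> M 1"
    by (metis M_ideal ring_ideal_add ring_ideal_mult_left)
  with one_notin show False by simp
qed

lemma M1_power: "x ^ k \<in> M 1 \<Longrightarrow> x \<in> M 1"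
  by (induction k) (use one_notin M1_prime in auto)

lemma power_in_M: "x \<in> M 1 \<Longrightarrow> x ^ k \<in> M k"
  by (induction k) (use M_0 M_mult[of x 1] in auto)

text \<open>By induction on \<open>k\<close>: \<open>M k\<close> is finitely generated, and modulo
  \<open>M (Suc k)\<close> the coefficients of its generators matter only modulo \<open>M 1\<close>,
  so that finitely many residues suffice.\<close>

lemma finite_quotient: "\<exists>R. finite R \<and> (\<forall>x. \<exists>r\<in>R. x - r \<in> M k)"
proof (induction k)
  case 0
  show ?case using M_0 by (intro exI[of _ "{0}"]) auto
next
  case (Suc k)
  obtain R1 where R1: "finite R1" "\<And>x. \<exists>r\<in>R1. x - r \<in> M 1" using finite_residue by blast
  obtain R where R: "finite R" "\<And>x. \<exists>r\<in>R. x - r \<in> M k" using Suc by blast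
  obtain A where A: "finite A" "M k = ideal_gen A" using noetherian[OF M_ideal] by blast
  \<comment> \<open>Stated for any finite subset \<open>B\<close> of \<open>M k\<close> in place of
    the generators \<open>A\<close>, so that they can be added one by one.\<close>
  have "\<exists>S. finite S \<and> (\<forall>x\<in>ideal_gen B. \<exists>r\<in>S. x - r \<in> M (Suc k))" if "finite B" "B \<subseteq> M k" for B
    using that
  proof (induction B rule: finite_induct)
    case empty
    then show ?case
      by (intro exI[of _ "{0}"]) (use ring_ideal_0[OF M_ideal] in \<open>auto simp: ideal_gen_empty\<close>)
  next
    case (insert b B)
    then obtain S where S: "finite S" "\<And>x. x \<in> ideal_gen B \<Longrightarrow> \<exists>r\<in>S. x - r \<in> M (Suc k)"
      by auto
    let ?S = "(\<lambda>(s, r). s + r * b) ` (S \<times> R1)"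
    have "\<exists>s\<in>?S. x - s \<in> M (Suc k)" if x: "x \<in> ideal_gen (insert b B)" for x
    proof -
      obtain y r where y: "y \<in> ideal_gen B" "x = y + r * b" using ideal_gen_insertE[OF x] .
      obtain s where s: "s \<in> S" "y - s \<in> M (Suc k)" using S(2)[OF y(1)] by blast
      obtain t where t: "t \<in> R1" "r - t \<in> M 1" using R1 by blast
      have "(r - t) * b \<in> M (Suc k)" using M_mult[OF t(2), of b k] insert.prems by simp
      then have "x - (s + t * b) \<in> M (Suc k)"
        using ring_ideal_add[OF M_ideal s(2), of "(r - t) * b"] y(2) by (simp add: algebra_simps)
      then show ?thesis using s t by force
    qed
    then show ?case using S R1 by (intro exI[of _ ?S]) auto
  qed
  from this[OF A(1)] A ideal_gen_incl[of A]
  obtain S where S: "finite S" "\<And>x. x \<in> M k \<Longrightarrow> \<exists>r\<in>S. x - r \<in> M (Suc k)" by auto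
  let ?S = "(\<lambda>(r, s). r + s) ` (R \<times> S)"
  have "\<exists>s\<in>?S. x - s \<in> M (Suc k)" for x
  proof -
    obtain r where r: "r \<in> R" "x - r \<in> M k" using R by blast
    obtain s where s: "s \<in> S" "x - r - s \<in> M (Suc k)" using S(2)[OF r(2)] by blast
    then have "x - (r + s) \<in> M (Suc k)" by (simp add: algebra_simps)
    then show ?thesis using r s by force
  qed
  then show ?case using R S by (intro exI[of _ ?S]) auto
qed

text \<open>Konig's lemma. Each \<open>T k\<close> is a union of cosets of \<open>M k\<close>. As
  there are finitely many cosets at each level, one can descend through nested cosets that meet all
  \<open>T l\<close>; the limit lies in every \<open>T k\<close>.\<close>

lemma compactness:
  fixes T :: "nat \<Rightarrow> 'a set"
  assumes ne: "\<And>k. T k \<noteq> {}" and dec: "\<And>k. T (Suc k) \<subseteq> T k"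
    and open_T: "\<And>k x y. x \<in> T k \<Longrightarrow> y - x \<in> M k \<Longrightarrow> y \<in> T k"
  shows "\<exists>x. \<forall>k. x \<in> T k"
proof -
  have anti: "T j \<subseteq> T i" if "i \<le> j" for i j
    by (rule lift_Suc_antimono_le[of T]) (use dec that in auto)
  \<comment> \<open>The coset of \<open>x\<close> modulo \<open>M k\<close> has to meet every
    \<open>T l\<close>, not only \<open>T k\<close>; this is what allows the descent to
    continue.\<close>
  define good where "good k x \<longleftrightarrow> (\<forall>l. \<exists>r\<in>T l. r - x \<in> M k)" for k x
  have good0: "good 0 0" unfolding good_def M_0 using ne by auto
  have step: "\<exists>y. good (Suc k) y \<and> y - x \<in> M k" if "good k x" for k x
  proof -
    obtain R where R: "finite R" "\<And>x. \<exists>r\<in>R. x - r \<in> M (Suc k)" using finite_quotient by blast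
    have "\<forall>l. \<exists>r. r \<in> T l \<and> r - x \<in> M k" using that unfolding good_def by auto
    then obtain u where u: "\<And>l. u l \<in> T l" "\<And>l. u l - x \<in> M k" by metis
    obtain f where f: "\<And>x. f x \<in> R" "\<And>x. x - f x \<in> M (Suc k)" using R(2) unfolding Bex_def by metis
    define c where "c l = f (u l)" for l
    have c: "\<And>l. c l \<in> R" "\<And>l. u l - c l \<in> M (Suc k)" using f by (simp_all add: c_def)
    have "finite (range c)" using R c by (auto intro: finite_subset[of _ R])
    \<comment> \<open>Some class modulo \<open>M (Suc k)\<close> contains \<open>u l\<close> for
      infinitely many \<open>l\<close>; as the sets \<open>T l\<close> decrease, it meets all of
      them.\<close>
    then obtain l0 where inf: "infinite {l. c l = c l0}"
      using pigeonhole_infinite[of "UNIV :: nat set" c] by auto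
    have "good (Suc k) (c l0)"
      unfolding good_def
    proof
      fix l
      obtain l' where l': "l' > l" "c l' = c l0" using inf unfolding infinite_nat_iff_unbounded by auto
      then show "\<exists>r\<in>T l. r - c l0 \<in> M (Suc k)"
        using u(1)[of l'] c(2)[of l'] anti[of l l'] by (intro bexI[of _ "u l'"]) auto
    qed
    moreover have "c l0 - x \<in> M k"
      using ring_ideal_minus[OF M_ideal u(2)[of l0], of "u l0 - c l0"] c(2)[of l0] M_Suc by auto
    ultimately show ?thesis by blast
  qed
  define s where "s = rec_nat 0 (\<lambda>k x. SOME y. good (Suc k) y \<and> y - x \<in> M k)"
  have s0: "s 0 = 0" and sS: "s (Suc k) = (SOME y. good (Suc k) y \<and> y - s k \<in> M k)" for k
    by (simp_all add: s_def)
  have gs: "good k (s k)" for k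
  proof (induction k)
    case (Suc k)
    from someI_ex[OF step[OF this]] show ?case by (simp add: sS)
  qed (simp add: s0 good0)
  have "s (Suc k) - s k \<in> M k" for k
    using someI_ex[OF step[OF gs[of k]]] by (simp add: sS)
  then obtain x where x: "\<And>k. x - s k \<in> M k" using complete by blast
  have "x \<in> T k" for k
  proof -
    obtain r where r: "r \<in> T k" "r - s k \<in> M k" using gs[of k] unfolding good_def by blast
    then have "x - r \<in> M k" using ring_ideal_minus[OF M_ideal x[of k] r(2)] by simp
    then show ?thesis using open_T r by blast
  qed
  then show ?thesis by blast
qed

text \<open>Krull's intersection theorem; since the ring is compact, it can be proved by adding one
  generator at a time.\<close>

lemma ideal_closed:
  assumes I: "ring_ideal I" and x: "\<And>k. x \<in> ideal_add I (M k)"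
  shows "x \<in> I"
proof -
  obtain A where A: "finite A" "I = ideal_gen A" using noetherian[OF I] by blast
  have "x \<in> ideal_gen A" if "finite A" "\<And>k. x \<in> ideal_add (ideal_gen A) (M k)" for A x
    using that
  proof (induction A arbitrary: x rule: finite_induct)
    case empty
    then show ?case using separated by (auto simp: ideal_gen_empty ideal_add_def)
  next
    case (insert b A)
    let ?I = "ideal_gen A"
    \<comment> \<open>The coefficients \<open>r\<close> of the new generator that bring
      \<open>x - r * b\<close> close to the smaller ideal. By compactness one \<open>r\<close>
      serves for all \<open>k\<close>, and the induction hypothesis applies to
      \<open>x - r * b\<close>.\<close>
    let ?T = "\<lambda>k. {r. x - r * b \<in> ideal_add ?I (M k)}"
    have idl: "ring_ideal (ideal_add ?I (M k))" for k
      by (intro ring_ideal_ideal_add ring_ideal_ideal_gen M_ideal)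
    have "\<exists>r. \<forall>k. r \<in> ?T k"
    proof (rule compactness)
      fix k
      obtain y z where yz: "x = y + z" "y \<in> ideal_gen (insert b A)" "z \<in> M k"
        using insert.prems[of k] by (auto simp: ideal_add_def)
      obtain y' r where "y' \<in> ?I" "y = y' + r * b" using ideal_gen_insertE[OF yz(2)] .
      then have "x - r * b \<in> ideal_add ?I (M k)" using yz by (simp add: ideal_addI)
      then show "?T k \<noteq> {}" by blast
    next
      fix k show "?T (Suc k) \<subseteq> ?T k" using M_Suc by (auto simp: ideal_add_def)
    next
      fix k r r' assume r: "r \<in> ?T k" "r' - r \<in> M k"
      have "(r' - r) * b \<in> ideal_add ?I (M k)"
        by (intro ideal_add_right ring_ideal_ideal_gen ring_ideal_mult_right M_ideal r)
      from ring_ideal_minus[OF idl _ this, of "x - r * b"] r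
      show "r' \<in> ?T k" by (simp add: algebra_simps)
    qed
    then obtain r where "\<And>k. x - r * b \<in> ideal_add ?I (M k)" by auto
    then have "x - r * b \<in> ?I" by (rule insert.IH)
    then have "x - r * b \<in> ideal_gen (insert b A)"
      using ideal_gen_minimal[OF ring_ideal_ideal_gen, of A "insert b A"] ideal_gen_incl[of "insert b A"]
      by blast
    moreover have "r * b \<in> ideal_gen (insert b A)"
      using ideal_gen_incl[of "insert b A"] by (intro ring_ideal_mult_left ring_ideal_ideal_gen) auto
    ultimately show ?case
      using ring_ideal_add[OF ring_ideal_ideal_gen, of "x - r * b" "insert b A" "r * b"] by simp
  qed
  from this[OF A(1)] x A show ?thesis by simp
qed

text \<open>That \<open>M 1\<close> contains every proper ideal follows from the closedness of
  ideals: if \<open>x \<in> I\<close> is outside \<open>M 1\<close>, choose \<open>a\<close> with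
  \<open>1 - a * x\<close> in \<open>M 1\<close>; then the elements
  \<open>1 - (1 - a * x) ^ k\<close> of \<open>I\<close> converge to \<open>1\<close>.\<close>

lemma proper_ideal_le:
  assumes I: "ring_ideal I" and one: "1 \<notin> I"
  shows "I \<subseteq> M 1"
proof
  fix x assume x: "x \<in> I"
  show "x \<in> M 1"
  proof (rule ccontr)
    assume "x \<notin> M 1"
    then obtain a where a: "1 - a * x \<in> M 1" using maximal by blast
    have "1 \<in> ideal_add I (M k)" for k
    proof (rule ideal_add_minusI[OF M_ideal])
      have "1 - (1 - a * x) ^ k \<in> I"
        using ring_ideal_power_cong[OF I, of 1 "1 - a * x" k] ring_ideal_mult_left[OF I x, of a] by simp
      then show "1 - (1 - a * x) ^ k \<in> I" .
      show "1 - (1 - (1 - a * x) ^ k) \<in> M k" using power_in_M[OF a] by simp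
    qed
    then have "1 \<in> I" by (rule ideal_closed[OF I])
    with one show False ..
  qed
qed

text \<open>Two different natural numbers agree in the finite residue field, so \<open>p\<close> is
  not \<open>0\<close>; its primality is inherited from the prime ideal \<open>M 1\<close>.\<close>

lemma prime_p: "prime p"
proof -
  have p1: "p \<noteq> 1" using characteristic[of 1] one_notin by simp
  have p0: "p \<noteq> 0"
  proof
    assume p0: "p = 0"
    obtain R where R: "finite R" "\<And>x. \<exists>r\<in>R. x - r \<in> M 1" using finite_residue by blast
    obtain f where f: "\<And>x. f x \<in> R" "\<And>x. x - f x \<in> M 1" using R(2) unfolding Bex_def by metis
    define c where "c k = f (of_nat k)" for k
    have c: "\<And>k. c k \<in> R" "\<And>k. of_nat k - c k \<in> M 1" using f by (simp_all add: c_def)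
    have "\<not> inj c" using R(1) c(1) by (meson finite_subset image_subsetI infinite_UNIV_nat finite_imageD)
    then obtain i j where ij: "i < j" "c i = c j"
      unfolding inj_def by (metis linorder_neqE_nat)
    have "of_nat j - of_nat i \<in> M 1"
      using ring_ideal_minus[OF M_ideal c(2)[of j] c(2)[of i]] ij by simp
    then have "of_nat (j - i) \<in> M 1" using ij by (simp add: of_nat_diff)
    then show False using characteristic[of "j - i"] p0 ij by simp
  qed
  show ?thesis
    unfolding prime_def prime_elem_def
  proof (intro conjI allI impI)
    fix a b assume "p dvd a * b"
    then have "of_nat a * of_nat b \<in> M 1" using characteristic[of "a * b"] by simp
    then show "p dvd a \<or> p dvd b" using M1_prime characteristic by blast
  qed (use p0 p1 in auto)
qed

end

section \<open>Prime ideals and Noetherian induction\<close>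

definition ring_prime_ideal :: "'a::comm_ring_1 set \<Rightarrow> bool" where
  "ring_prime_ideal P \<longleftrightarrow> ring_ideal P \<and> 1 \<notin> P \<and> (\<forall>a b. a * b \<in> P \<longrightarrow> a \<in> P \<or> b \<in> P)"

lemma ring_prime_ideal_ideal: "ring_prime_ideal P \<Longrightarrow> ring_ideal P"
  and ring_prime_ideal_one: "ring_prime_ideal P \<Longrightarrow> 1 \<notin> P"
  and ring_prime_ideal_mult: "ring_prime_ideal P \<Longrightarrow> a * b \<in> P \<Longrightarrow> a \<in> P \<or> b \<in> P"
  by (auto simp: ring_prime_ideal_def)

lemma ring_prime_ideal_power: "ring_prime_ideal P \<Longrightarrow> a ^ k \<in> P \<Longrightarrow> a \<in> P"
  by (induction k) (auto dest: ring_prime_ideal_mult simp: ring_prime_ideal_one)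

context complete_local
begin

text \<open>If \<open>Q\<close> fails, it fails for some ideal \<open>N\<close> maximal among the
  failures. This \<open>N\<close> is not prime: \<open>a * b \<in> N\<close> with \<open>a\<close>
  and \<open>b\<close> outside. The ideals generated by \<open>N\<close> with \<open>a\<close> and
  by \<open>N\<close> with \<open>b\<close> are larger, hence satisfy \<open>Q\<close>, and their
  product lies in \<open>N\<close>.\<close>

lemma noetherian_induct:
  fixes Q :: "'a set \<Rightarrow> bool"
  assumes prime_case: "\<And>P. ring_prime_ideal P \<Longrightarrow> Q P"
    and unit_case: "Q UNIV"
    and mult_case: "\<And>I I1 I2. ring_ideal I \<Longrightarrow> ring_ideal I1 \<Longrightarrow> ring_ideal I2 \<Longrightarrow> Q I1 \<Longrightarrow> Q I2 \<Longrightarrow>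
      (\<And>x y. x \<in> I1 \<Longrightarrow> y \<in> I2 \<Longrightarrow> x * y \<in> I) \<Longrightarrow> Q I"
    and I: "ring_ideal I"
  shows "Q I"
proof (rule ccontr)
  assume nQ: "\<not> Q I"
  let ?A = "{I. ring_ideal I \<and> \<not> Q I}"
  have "\<exists>N\<in>?A. \<forall>X\<in>?A. N \<subseteq> X \<longrightarrow> X = N"
  proof (rule subset_Zorn_nonempty)
    show "?A \<noteq> {}" using I nQ by blast
  next
    fix C assume C: "C \<noteq> {}" "subset.chain ?A C"
    then have ch: "\<And>X. X \<in> C \<Longrightarrow> ring_ideal X \<and> \<not> Q X"
      "\<And>X Y. X \<in> C \<Longrightarrow> Y \<in> C \<Longrightarrow> X \<subseteq> Y \<or> Y \<subseteq> X"
      unfolding subset.chain_def by blast+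
    have idl: "ring_ideal (\<Union>C)"
      unfolding ring_ideal_def
    proof (intro conjI ballI allI)
      show "0 \<in> \<Union>C" using C(1) ch ring_ideal_0 by blast
    next
      fix x y assume "x \<in> \<Union>C" "y \<in> \<Union>C"
      then obtain X Y where "X \<in> C" "Y \<in> C" "x \<in> X" "y \<in> Y" by blast
      then show "x + y \<in> \<Union>C" using ch ring_ideal_add by (metis UnionI subsetD)
    next
      fix a x assume "x \<in> \<Union>C"
      then show "a * x \<in> \<Union>C" using ch ring_ideal_mult_left by (metis UnionE UnionI)
    qed
    obtain A where A: "finite A" "\<Union>C = ideal_gen A" using noetherian[OF idl] by blast
    \<comment> \<open>A finite generating set of the union lies in one member of the chain, which is
      then the whole union.\<close>
    have "finite B \<Longrightarrow> B \<subseteq> \<Union>C \<Longrightarrow> \<exists>X\<in>C. B \<subseteq> X" for B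
    proof (induction B rule: finite_induct)
      case (insert b B)
      then obtain X Y where "X \<in> C" "Y \<in> C" "B \<subseteq> X" "b \<in> Y" by auto
      then show ?case using ch(2)[of X Y] by blast
    qed (use C in auto)
    from this[OF A(1)] A(2) ideal_gen_incl[of A] obtain X where X: "X \<in> C" "A \<subseteq> X" by auto
    then have "\<Union>C \<subseteq> X" using ideal_gen_minimal[of X A] ch A(2) by auto
    then have "\<Union>C = X" using X by blast
    then show "\<Union>C \<in> ?A" using ch X by auto
  qed
  then obtain N where N: "ring_ideal N" "\<not> Q N"
    and max: "\<And>X. ring_ideal X \<Longrightarrow> N \<subseteq> X \<Longrightarrow> X \<noteq> N \<Longrightarrow> Q X" by blast
  have one: "1 \<notin> N" using N unit_case ring_ideal_UNIV_iff by metis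
  have "\<not> ring_prime_ideal N" using prime_case N by blast
  then obtain a b where ab: "a * b \<in> N" "a \<notin> N" "b \<notin> N"
    using N one unfolding ring_prime_ideal_def by blast
  define E where "E c = ideal_add N {r * c | r. True}" for c
  have E: "ring_ideal (E c)" for c
    unfolding E_def by (intro ring_ideal_ideal_add N ring_ideal_principal)
  have NE: "N \<subseteq> E c" for c
    unfolding E_def using ideal_add_left[OF ring_ideal_principal] by blast
  have cE: "c \<in> E c" for c
    unfolding E_def by (rule ideal_add_right[OF N(1)]) (auto intro!: exI[of _ 1])
  have "Q (E a)" "Q (E b)" using max[OF E NE] cE ab by metis+
  moreover have "x * y \<in> N" if xy: "x \<in> E a" "y \<in> E b" for x y
  proof -
    obtain u v r s where *: "x = u + r * a" "y = v + s * b" "u \<in> N" "v \<in> N"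
      using xy unfolding E_def ideal_add_def by blast
    have "x * y = y * u + (r * a) * v + (r * s) * (a * b)" unfolding * by (simp add: algebra_simps)
    then show ?thesis using * ab by (metis N(1) ring_ideal_add ring_ideal_mult_left)
  qed
  ultimately have "Q N" by (rule mult_case[OF N(1) E E])
  with N show False by simp
qed

end

section \<open>Matrices modulo an ideal\<close>

lemmas square_mat_simps =
  assoc_mult_mat[of _ n n _ n _ n] mult_smult_distrib[of _ n n _ n] mult_smult_assoc_mat[of _ n n _ n]
  mult_add_distrib_mat[of _ n n _ n] add_mult_distrib_mat[of _ n n _ _ n]
  minus_mult_distrib_mat[of _ n n _ _ n] mult_minus_distrib_mat[of _ n n _ n] for n

declare minus_carrier_mat [simp]

lemma smult_smult_mat: "a \<cdot>\<^sub>m (b \<cdot>\<^sub>m A) = (a * b :: 'a::comm_ring_1) \<cdot>\<^sub>m A"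
  by (intro eq_matI) (auto simp: mult.assoc)

definition mat_cong :: "nat \<Rightarrow> 'a::comm_ring_1 set \<Rightarrow> 'a mat \<Rightarrow> 'a mat \<Rightarrow> bool" where
  "mat_cong n I X Y \<longleftrightarrow> X \<in> carrier_mat n n \<and> Y \<in> carrier_mat n n \<and>
     (\<forall>i<n. \<forall>j<n. X $$ (i, j) - Y $$ (i, j) \<in> I)"

lemma mat_congD:
  "mat_cong n I X Y \<Longrightarrow> X \<in> carrier_mat n n"
  "mat_cong n I X Y \<Longrightarrow> Y \<in> carrier_mat n n"
  "mat_cong n I X Y \<Longrightarrow> i < n \<Longrightarrow> j < n \<Longrightarrow> X $$ (i, j) - Y $$ (i, j) \<in> I"
  by (auto simp: mat_cong_def)

lemma mat_cong_refl: "ring_ideal I \<Longrightarrow> X \<in> carrier_mat n n \<Longrightarrow> mat_cong n I X X"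
  by (simp add: mat_cong_def ring_ideal_0)

lemma mat_cong_sym: "ring_ideal I \<Longrightarrow> mat_cong n I X Y \<Longrightarrow> mat_cong n I Y X"
  by (auto simp: mat_cong_def intro: ring_ideal_minus_commute)

lemma mat_cong_trans:
  "ring_ideal I \<Longrightarrow> mat_cong n I X Y \<Longrightarrow> mat_cong n I Y Z \<Longrightarrow> mat_cong n I X Z"
  unfolding mat_cong_def by (meson ring_ideal_minus_trans)

lemma mat_cong_mono: "I \<subseteq> J \<Longrightarrow> mat_cong n I X Y \<Longrightarrow> mat_cong n J X Y"
  by (auto simp: mat_cong_def)

lemma mat_cong_UNIV: "X \<in> carrier_mat n n \<Longrightarrow> Y \<in> carrier_mat n n \<Longrightarrow> mat_cong n UNIV X Y"
  by (auto simp: mat_cong_def)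

lemma mat_cong_add:
  assumes "ring_ideal I" "mat_cong n I X Y" "mat_cong n I X' Y'"
  shows "mat_cong n I (X + X') (Y + Y')"
  unfolding mat_cong_def
proof (intro conjI allI impI)
  note c = assms(2,3)[THEN mat_congD(1)] assms(2,3)[THEN mat_congD(2)]
  show "X + X' \<in> carrier_mat n n" "Y + Y' \<in> carrier_mat n n" using c by auto
  fix i j assume ij: "i < n" "j < n"
  have "(X $$ (i, j) - Y $$ (i, j)) + (X' $$ (i, j) - Y' $$ (i, j)) \<in> I"
    using assms ij by (auto intro!: ring_ideal_add dest: mat_congD(3))
  then show "(X + X') $$ (i, j) - (Y + Y') $$ (i, j) \<in> I" using c ij by (simp add: algebra_simps)
qed

lemma mat_cong_minus:
  assumes "ring_ideal I" "mat_cong n I X Y" "mat_cong n I X' Y'"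
  shows "mat_cong n I (X - X') (Y - Y')"
  unfolding mat_cong_def
proof (intro conjI allI impI)
  note c = assms(2,3)[THEN mat_congD(1)] assms(2,3)[THEN mat_congD(2)]
  show "X - X' \<in> carrier_mat n n" "Y - Y' \<in> carrier_mat n n" using c by auto
  fix i j assume ij: "i < n" "j < n"
  have "(X $$ (i, j) - Y $$ (i, j)) - (X' $$ (i, j) - Y' $$ (i, j)) \<in> I"
    by (intro ring_ideal_minus assms(1) mat_congD(3)[OF assms(2)] mat_congD(3)[OF assms(3)] ij)
  then show "(X - X') $$ (i, j) - (Y - Y') $$ (i, j) \<in> I" using c ij by (simp add: algebra_simps)
qed

lemma mult_mat_entry:
  assumes "X \<in> carrier_mat n n" "Y \<in> carrier_mat n n" "i < n" "j < n"
  shows "(X * Y) $$ (i, j) = (\<Sum>k<n. X $$ (i, k) * Y $$ (k, j))"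
  using assms by (auto simp: scalar_prod_def atLeast0LessThan intro!: sum.cong)

lemma mat_cong_mult:
  assumes "ring_ideal I" "mat_cong n I X Y" "mat_cong n I X' Y'"
  shows "mat_cong n I (X * X') (Y * Y')"
  unfolding mat_cong_def
proof (intro conjI allI impI)
  note c = assms(2,3)[THEN mat_congD(1)] assms(2,3)[THEN mat_congD(2)]
  show "X * X' \<in> carrier_mat n n" "Y * Y' \<in> carrier_mat n n" using c by auto
  fix i j assume ij: "i < n" "j < n"
  have "(\<Sum>k<n. X $$ (i, k) * X' $$ (k, j) - Y $$ (i, k) * Y' $$ (k, j)) \<in> I"
    using assms ij by (auto intro!: ring_ideal_sum ring_ideal_mult_cong dest: mat_congD(3))
  then show "(X * X') $$ (i, j) - (Y * Y') $$ (i, j) \<in> I"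
    using c ij by (simp only: mult_mat_entry sum_subtractf)
qed

lemma mat_cong_smult:
  assumes "ring_ideal I" "a - b \<in> I" "mat_cong n I X Y"
  shows "mat_cong n I (a \<cdot>\<^sub>m X) (b \<cdot>\<^sub>m Y)"
  using assms by (auto simp: mat_cong_def intro!: ring_ideal_mult_cong)

lemma mat_cong_pow:
  assumes "ring_ideal I" "mat_cong n I X Y"
  shows "mat_cong n I (X ^\<^sub>m k) (Y ^\<^sub>m k)"
proof (induction k)
  case 0
  then show ?case using assms mat_congD[OF assms(2)] by (simp add: mat_cong_refl)
next
  case (Suc k)
  then show ?case using assms by (simp add: mat_cong_mult)
qed

lemma one_pow_mat: "1\<^sub>m n ^\<^sub>m k = 1\<^sub>m n"
  by (induction k) auto

lemma det_cong:
  assumes "ring_ideal I" "mat_cong n I X Y"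
  shows "det X - det Y \<in> I"
proof -
  note c = mat_congD[OF assms(2)]
  have "det X - det Y = (\<Sum>p | p permutes {0..<n}. signof p *
      ((\<Prod>i = 0..<n. X $$ (i, p i)) - (\<Prod>i = 0..<n. Y $$ (i, p i))))"
    using c(1,2) by (simp add: det_def' sum_subtractf right_diff_distrib)
  also have "\<dots> \<in> I"
    using assms(1) c(3)
    by (intro ring_ideal_sum ring_ideal_mult_left ring_ideal_prod_cong) (auto simp: permutes_in_image)
  finally show ?thesis .
qed

section \<open>The Frobenius congruence and polynomials in a matrix\<close>

lemma prime_power_binomial:
  fixes x y :: "'a::comm_ring_1"
  assumes "prime p"
  shows "\<exists>z. (x + y) ^ (p ^ k) = x ^ (p ^ k) + y ^ (p ^ k) + of_nat p * z"
proof -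
  \<comment> \<open>The error is kept as an explicit multiple of \<open>p\<close>, so that the
    result can also be used in the polynomial ring over \<open>'a\<close>. The divisibility of
    \<open>p choose i\<close> gives the first power; iteration gives the others.\<close>
  have step: "\<exists>z. (x + y) ^ p = x ^ p + y ^ p + of_nat p * z" for x y :: 'a
  proof -
    have p0: "0 < p" using assms prime_gt_0_nat by blast
    have "\<forall>i\<in>{1..<p}. \<exists>c. p choose i = p * c"
      using assms dvd_choose_prime[of _ p] by (auto simp: dvd_def)
    then obtain c where c: "\<And>i. i \<in> {1..<p} \<Longrightarrow> p choose i = p * c i" by metis
    have "(x + y) ^ p = (\<Sum>i\<le>p. of_nat (p choose i) * x ^ i * y ^ (p - i))"
      by (rule binomial_ring)
    also have "{..p} = insert 0 (insert p {1..<p})" using p0 by auto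
    also have "(\<Sum>i\<in>\<dots>. of_nat (p choose i) * x ^ i * y ^ (p - i)) =
        y ^ p + (x ^ p + (\<Sum>i\<in>{1..<p}. of_nat (p choose i) * x ^ i * y ^ (p - i)))"
      using p0 by (subst sum.insert; (subst sum.insert)?; auto)
    also have "(\<Sum>i\<in>{1..<p}. of_nat (p choose i) * x ^ i * y ^ (p - i)) =
        of_nat p * (\<Sum>i\<in>{1..<p}. of_nat (c i) * x ^ i * y ^ (p - i))"
      unfolding sum_distrib_left using c by (intro sum.cong) (auto simp: mult.assoc)
    finally have "(x + y) ^ p = x ^ p + y ^ p +
        of_nat p * (\<Sum>i\<in>{1..<p}. of_nat (c i) * x ^ i * y ^ (p - i))"
      by (simp add: ac_simps)
    then show ?thesis by blast
  qed
  show ?thesis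
  proof (induction k)
    case (Suc k)
    then obtain z where z: "(x + y) ^ (p ^ k) = x ^ (p ^ k) + y ^ (p ^ k) + of_nat p * z" by blast
    obtain u where u: "(x ^ (p ^ k) + y ^ (p ^ k)) ^ p = x ^ (p ^ Suc k) + y ^ (p ^ Suc k) + of_nat p * u"
      using step[of "x ^ (p ^ k)" "y ^ (p ^ k)"] by (auto simp flip: power_mult simp: mult.commute)
    obtain v where v: "(x ^ (p ^ k) + y ^ (p ^ k) + of_nat p * z) ^ p =
        (x ^ (p ^ k) + y ^ (p ^ k)) ^ p + (of_nat p * z) ^ p + of_nat p * v"
      using step[of "x ^ (p ^ k) + y ^ (p ^ k)" "of_nat p * z"] by blast
    obtain w where w: "(of_nat p * z) ^ p = of_nat p * w"
      using assms prime_gt_0_nat[of p] by (cases p) (auto simp: mult.assoc)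
    have "(x + y) ^ (p ^ Suc k) = ((x + y) ^ (p ^ k)) ^ p"
      by (simp flip: power_mult add: mult.commute)
    also have "\<dots> = x ^ (p ^ Suc k) + y ^ (p ^ Suc k) + of_nat p * (u + w + v)"
      unfolding z v u w by (simp add: algebra_simps)
    finally show ?case by blast
  qed (auto intro: exI[of _ 0])
qed

text \<open>The binomial congruence is applied to \<open>(x - y) + y\<close>, which avoids the sign
  of a power of \<open>- y\<close>.\<close>

lemma prime_power_diff_cong:
  fixes x y :: "'a::comm_ring_1"
  assumes "prime p" "ring_ideal I" "of_nat p \<in> I"
  shows "(x - y) ^ (p ^ k) - (x ^ (p ^ k) - y ^ (p ^ k)) \<in> I"
proof -
  obtain z where "(x - y + y) ^ (p ^ k) = (x - y) ^ (p ^ k) + y ^ (p ^ k) + of_nat p * z"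
    using prime_power_binomial[OF assms(1)] by blast
  then have "(x - y) ^ (p ^ k) - (x ^ (p ^ k) - y ^ (p ^ k)) = of_nat p * (- z)"
    by (simp add: algebra_simps)
  then show ?thesis using assms(2,3) by (metis ring_ideal_mult_right)
qed

text \<open>Horner evaluation of a polynomial at a square matrix. It carries identities from the
  commutative polynomial ring over to the powers of a single matrix.\<close>

definition poly_mat :: "nat \<Rightarrow> 'a::comm_ring_1 poly \<Rightarrow> 'a mat \<Rightarrow> 'a mat" where
  "poly_mat n f X = fold_coeffs (\<lambda>c Y. c \<cdot>\<^sub>m 1\<^sub>m n + X * Y) f (0\<^sub>m n n)"

lemma poly_mat_0 [simp]: "poly_mat n 0 X = 0\<^sub>m n n"
  by (simp add: poly_mat_def)

lemma poly_mat_pCons: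
  assumes "X \<in> carrier_mat n n"
  shows "poly_mat n (pCons c f) X = c \<cdot>\<^sub>m 1\<^sub>m n + X * poly_mat n f X"
proof (cases "c = 0 \<and> f = 0")
  case True
  have "0 \<cdot>\<^sub>m 1\<^sub>m n = (0\<^sub>m n n :: 'a mat)" by (intro eq_matI) auto
  then show ?thesis using assms True by simp
qed (auto simp: poly_mat_def)

lemma poly_mat_carrier [simp]:
  "X \<in> carrier_mat n n \<Longrightarrow> poly_mat n f X \<in> carrier_mat n n"
  by (induction f) (auto simp: poly_mat_pCons)

lemma poly_mat_dim [simp]:
  "X \<in> carrier_mat n n \<Longrightarrow> dim_row (poly_mat n f X) = n"
  "X \<in> carrier_mat n n \<Longrightarrow> dim_col (poly_mat n f X) = n"
  using poly_mat_carrier by blast+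

lemma poly_mat_add:
  assumes X: "X \<in> carrier_mat n n"
  shows "poly_mat n (f + g) X = poly_mat n f X + poly_mat n g X"
proof (induction f g rule: poly_induct2)
  case (pCons a f b g)
  note c = poly_mat_carrier[OF X]
  show ?case
    unfolding add_pCons poly_mat_pCons[OF X] pCons.IH mult_add_distrib_mat[OF X c c]
    using X c[of f] c[of g] by (intro eq_matI) (auto simp: algebra_simps)
qed auto

lemma poly_mat_smult:
  assumes X: "X \<in> carrier_mat n n"
  shows "poly_mat n (Polynomial.smult a f) X = a \<cdot>\<^sub>m poly_mat n f X"
proof (induction f)
  case (pCons c f)
  note cf = poly_mat_carrier[OF X]
  show ?case
    unfolding smult_pCons poly_mat_pCons[OF X] pCons.IH mult_smult_distrib[OF X cf]
    using X cf[of f] by (intro eq_matI) (auto simp: algebra_simps)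
qed auto

lemma poly_mat_mult:
  assumes X: "X \<in> carrier_mat n n"
  shows "poly_mat n (f * g) X = poly_mat n f X * poly_mat n g X"
proof (induction f)
  case 0
  then show ?case using poly_mat_carrier[OF X, of g] by simp
next
  case (pCons a f)
  note c = poly_mat_carrier[OF X]
  have "poly_mat n (pCons a f * g) X = a \<cdot>\<^sub>m poly_mat n g X + X * (poly_mat n f X * poly_mat n g X)"
    using X c[of f] c[of g]
    unfolding mult_pCons_left poly_mat_add[OF X] poly_mat_smult[OF X] poly_mat_pCons[OF X] pCons.IH
    by (intro eq_matI) auto
  also have "\<dots> = poly_mat n (pCons a f) X * poly_mat n g X"
    unfolding poly_mat_pCons[OF X]
    using X c[of f] c[of g]
    by (simp add: square_mat_simps[where n = n])
  finally show ?case .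
qed

lemma poly_mat_one: "X \<in> carrier_mat n n \<Longrightarrow> poly_mat n 1 X = 1\<^sub>m n"
  unfolding one_pCons by (simp add: poly_mat_pCons) (intro eq_matI, auto)

lemma poly_mat_power:
  assumes X: "X \<in> carrier_mat n n"
  shows "poly_mat n (f ^ k) X = poly_mat n f X ^\<^sub>m k"
proof (induction k)
  case 0
  then show ?case using poly_mat_carrier[OF X, of f] by (simp add: poly_mat_one[OF X])
next
  case (Suc k)
  then show ?case by (simp add: power_Suc2 poly_mat_mult[OF X] del: power_Suc)
qed

lemma smult_pow_mat:
  fixes X :: "'a::comm_ring_1 mat"
  assumes "X \<in> carrier_mat n n"
  shows "(a \<cdot>\<^sub>m X) ^\<^sub>m k = a ^ k \<cdot>\<^sub>m (X ^\<^sub>m k)"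
proof (induction k)
  case (Suc k)
  have "(a ^ k \<cdot>\<^sub>m X ^\<^sub>m k) * (a \<cdot>\<^sub>m X) = (a * a ^ k) \<cdot>\<^sub>m (X ^\<^sub>m k * X)"
    using assms pow_carrier_mat[OF assms, of k]
    by (simp add: square_mat_simps[where n = n] smult_smult_mat)
  then show ?case by (simp add: Suc)
qed (use assms in \<open>auto intro!: eq_matI\<close>)

lemma det_pow_mat:
  assumes "X \<in> carrier_mat n n"
  shows "det (X ^\<^sub>m k) = det X ^ k"
  using assms by (induction k) (auto simp: det_mult[of _ n])

lemma pow_commutes_mat:
  assumes X: "X \<in> carrier_mat n n"
  shows "X ^\<^sub>m k * X = X * X ^\<^sub>m k"
proof (induction k)
  case (Suc k)
  have "X ^\<^sub>m Suc k * X = (X * X ^\<^sub>m k) * X" by (simp add: Suc)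
  also have "\<dots> = X * X ^\<^sub>m Suc k" using X by (simp add: assoc_mult_mat[of _ n n _ n _ n])
  finally show ?case .
qed (use X in auto)

text \<open>Let \<open>q = p ^ k\<close>. Modulo \<open>I\<close>, the \<open>q\<close>-th power of
  \<open>1 - a g\<close> is \<open>1 - a ^ q g ^ q\<close>, which is the scalar matrix
  \<open>1 - a ^ q\<close>. Hence \<open>det (1 - a g) ^ q\<close> is
  \<open>(1 - a ^ q) ^ n\<close>, the \<open>q\<close>-th power of \<open>(1 - a) ^ n\<close>, and a
  difference of \<open>q\<close>-th powers is the \<open>q\<close>-th power of the
  difference.\<close>

lemma det_one_minus_power_cong:
  fixes g :: "'a::comm_ring_1 mat"
  assumes p: "prime p" and I: "ring_ideal I" "of_nat p \<in> I"
    and g: "g \<in> carrier_mat n n" and torsion: "mat_cong n I (g ^\<^sub>m (p ^ k)) (1\<^sub>m n)"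
  shows "(det (1\<^sub>m n - a \<cdot>\<^sub>m g) - (1 - a) ^ n) ^ (p ^ k) \<in> I"
proof -
  let ?q = "p ^ k"
  \<comment> \<open>Polynomials with sum \<open>1\<close> whose values at \<open>g\<close> are
    \<open>1 - a g\<close> and \<open>a g\<close>.\<close>
  define u y :: "'a poly" where "u = [:1, -a:]" and "y = [:0, a:]"
  have "u + y = 1" by (simp add: u_def y_def one_pCons)
  then obtain z where z: "1 = u ^ ?q + y ^ ?q + of_nat p * z"
    using prime_power_binomial[OF p, of u y k] by auto
  have ymat: "poly_mat n y g = a \<cdot>\<^sub>m g"
    unfolding y_def using g by (simp add: poly_mat_pCons) (intro eq_matI, auto)
  have umat: "poly_mat n u g = 1\<^sub>m n - a \<cdot>\<^sub>m g"
    unfolding u_def using g by (simp add: poly_mat_pCons) (intro eq_matI, auto)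
  let ?U = "(1\<^sub>m n - a \<cdot>\<^sub>m g) ^\<^sub>m ?q" and ?Y = "(a \<cdot>\<^sub>m g) ^\<^sub>m ?q"
  have UY: "1\<^sub>m n = ?U + ?Y + of_nat p \<cdot>\<^sub>m poly_mat n z g"
  proof -
    have "poly_mat n 1 g = poly_mat n (u ^ ?q + y ^ ?q + Polynomial.smult (of_nat p) z) g"
      by (subst z) (simp add: of_nat_poly)
    then show ?thesis
      unfolding poly_mat_add[OF g] poly_mat_power[OF g] poly_mat_one[OF g] poly_mat_smult[OF g] umat ymat .
  qed
  note c = g poly_mat_carrier[OF g, of z] pow_carrier_mat[OF g, of ?q]
  have U: "?U \<in> carrier_mat n n" and Y: "?Y \<in> carrier_mat n n" using g by auto
  have "mat_cong n I ?U (1\<^sub>m n - ?Y)"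
    unfolding mat_cong_def
  proof (intro conjI allI impI)
    fix i j assume ij: "i < n" "j < n"
    have "(1\<^sub>m n - ?Y) $$ (i, j) = ?U $$ (i, j) + of_nat p * poly_mat n z g $$ (i, j)"
      by (subst UY) (use ij c U Y in simp)
    then show "?U $$ (i, j) - (1\<^sub>m n - ?Y) $$ (i, j) \<in> I"
      using I ring_ideal_mult_right[OF I, of "- poly_mat n z g $$ (i, j)"] by simp
  qed (use U Y in auto)
  moreover have "mat_cong n I ?Y (a ^ ?q \<cdot>\<^sub>m 1\<^sub>m n)"
    unfolding smult_pow_mat[OF g]
    by (rule mat_cong_smult[OF I(1) _ torsion]) (simp add: ring_ideal_0[OF I(1)])
  then have "mat_cong n I (1\<^sub>m n - ?Y) (1\<^sub>m n - a ^ ?q \<cdot>\<^sub>m 1\<^sub>m n)"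
    by (intro mat_cong_minus mat_cong_refl I) auto
  moreover have "1\<^sub>m n - a ^ ?q \<cdot>\<^sub>m 1\<^sub>m n = (1 - a ^ ?q) \<cdot>\<^sub>m 1\<^sub>m n"
    by (intro eq_matI) auto
  ultimately have "mat_cong n I ?U ((1 - a ^ ?q) \<cdot>\<^sub>m 1\<^sub>m n)"
    using mat_cong_trans[OF I(1)] by metis
  from det_cong[OF I(1) this]
  have 1: "det (1\<^sub>m n - a \<cdot>\<^sub>m g) ^ ?q - (1 - a ^ ?q) ^ n \<in> I"
    using g by (simp add: det_pow_mat[of _ n])
  have "(1 - a) ^ ?q - (1 - a ^ ?q) \<in> I"
    using prime_power_diff_cong[OF p I, of 1 a k] by simp
  from ring_ideal_power_cong[OF I(1) this, of n]
  have 2: "((1 - a) ^ n) ^ ?q - (1 - a ^ ?q) ^ n \<in> I"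
    by (simp flip: power_mult add: mult.commute)
  have "det (1\<^sub>m n - a \<cdot>\<^sub>m g) ^ ?q - ((1 - a) ^ n) ^ ?q \<in> I"
    using ring_ideal_minus_trans[OF I(1) 1 ring_ideal_minus_commute[OF I(1) 2]] .
  then show ?thesis
    using prime_power_diff_cong[OF p I, of "det (1\<^sub>m n - a \<cdot>\<^sub>m g)" "(1 - a) ^ n" k]
      ring_ideal_mem_cong[OF I(1)] by blast
qed

text \<open>The sum \<open>1 + X + ... + X ^ (k - 1)\<close>. It serves both as the cofactor of
  \<open>1 - X\<close> in \<open>1 - X ^ k\<close> and as a truncated inverse of
  \<open>1 - X\<close>.\<close>

primrec geo_mat :: "nat \<Rightarrow> 'a::comm_ring_1 mat \<Rightarrow> nat \<Rightarrow> 'a mat" where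
  "geo_mat n X 0 = 0\<^sub>m n n"
| "geo_mat n X (Suc k) = 1\<^sub>m n + X * geo_mat n X k"

lemma geo_mat_carrier [simp]: "X \<in> carrier_mat n n \<Longrightarrow> geo_mat n X k \<in> carrier_mat n n"
  by (induction k) auto

lemma geo_mat_dim [simp]:
  "X \<in> carrier_mat n n \<Longrightarrow> dim_row (geo_mat n X k) = n"
  "X \<in> carrier_mat n n \<Longrightarrow> dim_col (geo_mat n X k) = n"
  using geo_mat_carrier by blast+

lemma one_minus_mult_geo_mat:
  assumes X: "X \<in> carrier_mat n n"
  shows "(1\<^sub>m n - X) * geo_mat n X k = 1\<^sub>m n - X ^\<^sub>m k"
proof (induction k)
  case 0
  then show ?case using X by (simp) (intro eq_matI, auto)
next
  case (Suc k)
  note c = X geo_mat_carrier[OF X, of k] pow_carrier_mat[OF X, of k]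
  have "X ^\<^sub>m k * X = X * X ^\<^sub>m k"
    using X pow_commutes_mat[OF X] by simp
  moreover have "(1\<^sub>m n - X) * geo_mat n X (Suc k) = (1\<^sub>m n - X) + X * ((1\<^sub>m n - X) * geo_mat n X k)"
  proof -
    have "(1\<^sub>m n - X) * (X * geo_mat n X k) = X * ((1\<^sub>m n - X) * geo_mat n X k)"
      using c by (simp add: square_mat_simps[where n = n])
    then show ?thesis
      using c by (simp add: mult_add_distrib_mat[of _ n n _ n])
  qed
  moreover have "(1\<^sub>m n - X) + (X - Y) = 1\<^sub>m n - Y" if "Y \<in> carrier_mat n n" for Y
    using X that by (intro eq_matI) auto
  ultimately show ?case
    using c unfolding Suc.IH by (simp add: mult_minus_distrib_mat[of _ n n _ n])
qed

lemma geo_mat_cong: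
  assumes I: "ring_ideal I" and X: "mat_cong n I X (1\<^sub>m n)"
  shows "mat_cong n I (geo_mat n X k) (of_nat k \<cdot>\<^sub>m 1\<^sub>m n)"
proof (induction k)
  case 0
  have "0 \<cdot>\<^sub>m 1\<^sub>m n = (0\<^sub>m n n :: 'a mat)" by (intro eq_matI) auto
  then show ?case by (simp add: mat_cong_refl[OF I])
next
  case (Suc k)
  have "mat_cong n I (1\<^sub>m n + X * geo_mat n X k) (1\<^sub>m n + 1\<^sub>m n * (of_nat k \<cdot>\<^sub>m 1\<^sub>m n))"
    by (intro mat_cong_add mat_cong_mult mat_cong_refl I X Suc) simp
  moreover have "1\<^sub>m n + 1\<^sub>m n * (of_nat k \<cdot>\<^sub>m 1\<^sub>m n) = (of_nat (Suc k) \<cdot>\<^sub>m 1\<^sub>m n :: 'a mat)"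
    by (intro eq_matI) auto
  ultimately show ?case by simp
qed

text \<open>The determinant of \<open>1 + g + \<dots> + g ^ (q - 1)\<close> is congruent to \<open>q ^ n\<close> modulo \<open>J\<close>, hence
  nonzero modulo \<open>P\<close>, while the product of this matrix with \<open>1 - g\<close> vanishes modulo \<open>P\<close>.\<close>

lemma torsion_cong_one:
  assumes P: "ring_prime_ideal P" and J: "ring_ideal J"
    and q: "of_nat q ^ n \<notin> ideal_add P J"
    and g: "mat_cong n J g (1\<^sub>m n)" "mat_cong n P (g ^\<^sub>m q) (1\<^sub>m n)"
  shows "mat_cong n P g (1\<^sub>m n)"
proof -
  note PI = ring_prime_ideal_ideal[OF P]
  have gc: "g \<in> carrier_mat n n" using g(1) by (rule mat_congD)
  let ?Z = "geo_mat n g q"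
  have Z: "?Z \<in> carrier_mat n n" using gc by simp
  have "det ?Z - of_nat q ^ n \<in> J"
    using det_cong[OF J geo_mat_cong[OF J g(1)], of q] by simp
  then have dZ: "det ?Z \<notin> P"
    using q ideal_add_minusI[OF J, of "det ?Z" P "of_nat q ^ n"] ring_ideal_minus_commute[OF J] by blast
  have "mat_cong n P (1\<^sub>m n - g ^\<^sub>m q) (1\<^sub>m n - 1\<^sub>m n)"
    by (intro mat_cong_minus mat_cong_refl PI g) simp
  then have "mat_cong n P ((1\<^sub>m n - g) * ?Z) (0\<^sub>m n n)"
    unfolding one_minus_mult_geo_mat[OF gc] by (simp add: minus_r_inv_mat[of _ n n])
  \<comment> \<open>The adjugate turns the factor \<open>?Z\<close> into the scalar
    \<open>det ?Z\<close>, which can be cancelled entrywise because \<open>P\<close> is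
    prime.\<close>
  then have "mat_cong n P ((1\<^sub>m n - g) * ?Z * adj_mat ?Z) (0\<^sub>m n n * adj_mat ?Z)"
    by (intro mat_cong_mult mat_cong_refl PI adj_mat Z)
  moreover have "(1\<^sub>m n - g) * ?Z * adj_mat ?Z = det ?Z \<cdot>\<^sub>m (1\<^sub>m n - g)"
    using gc Z adj_mat[OF Z] by (simp add: assoc_mult_mat[of _ n n _ n _ n] mult_smult_distrib[of _ n n _ n])
  ultimately have *: "mat_cong n P (det ?Z \<cdot>\<^sub>m (1\<^sub>m n - g)) (0\<^sub>m n n)"
    using adj_mat(1)[OF Z] by simp
  show ?thesis
    unfolding mat_cong_def
  proof (intro conjI allI impI)
    fix i j assume ij: "i < n" "j < n"
    have "det ?Z * (1\<^sub>m n $$ (i, j) - g $$ (i, j)) \<in> P"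
      using mat_congD(3)[OF * ij] gc ij by simp
    then have "1\<^sub>m n $$ (i, j) - g $$ (i, j) \<in> P" using dZ ring_prime_ideal_mult[OF P] by blast
    then show "g $$ (i, j) - 1\<^sub>m n $$ (i, j) \<in> P" by (rule ring_ideal_minus_commute[OF PI])
  qed (use gc in auto)
qed

text \<open>Gaussian elimination without division, over the domain of residues modulo
  \<open>P\<close>.\<close>

lemma linear_dependence_mod_prime:
  fixes v :: "'b \<Rightarrow> nat \<Rightarrow> 'a::comm_ring_1"
  assumes P: "ring_prime_ideal P" and "finite I" "n < card I"
  shows "\<exists>c. (\<exists>i\<in>I. c i \<notin> P) \<and> (\<forall>k<n. (\<Sum>i\<in>I. c i * v i k) \<in> P)"
  using assms(2,3)
proof (induction n arbitrary: I v)
  case 0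
  then have "I \<noteq> {}" by auto
  then show ?case using ring_prime_ideal_one[OF P] by (intro exI[of _ "\<lambda>_. 1"]) auto
next
  case (Suc n)
  note PI = ring_prime_ideal_ideal[OF P]
  show ?case
  proof (cases "\<forall>i\<in>I. v i n \<in> P")
    case True
    obtain c where c: "\<exists>i\<in>I. c i \<notin> P" "\<And>k. k < n \<Longrightarrow> (\<Sum>i\<in>I. c i * v i k) \<in> P"
      using Suc.IH[of I v] Suc.prems by auto
    have "(\<Sum>i\<in>I. c i * v i n) \<in> P"
      using True by (intro ring_ideal_sum ring_ideal_mult_left PI) auto
    with c show ?thesis by (intro exI[of _ c]) (auto simp: less_Suc_eq)
  next
    case False
    then obtain i0 where i0: "i0 \<in> I" "v i0 n \<notin> P" by blast
    let ?I = "I - {i0}"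
    \<comment> \<open>The pivot \<open>v i0\<close> clears the last coordinate of the other vectors.
      A relation \<open>c\<close> among the \<open>w i\<close> becomes the relation \<open>d\<close>
      among the \<open>v i\<close>, which stays nontrivial because \<open>v i0 n\<close> is not in
      \<open>P\<close>.\<close>
    define w where "w i k = v i0 n * v i k - v i n * v i0 k" for i k
    obtain c where c: "\<exists>i\<in>?I. c i \<notin> P" "\<And>k. k < n \<Longrightarrow> (\<Sum>i\<in>?I. c i * w i k) \<in> P"
      using Suc.IH[of ?I w] Suc.prems i0 less_diff_conv[of n "card I" 1] by auto
    define d where "d i = (if i = i0 then - (\<Sum>i\<in>?I. c i * v i n) else c i * v i0 n)" for i
    have sum_d: "(\<Sum>i\<in>I. d i * v i k) = (\<Sum>i\<in>?I. c i * w i k)" for k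
    proof -
      have "(\<Sum>i\<in>I. d i * v i k) = d i0 * v i0 k + (\<Sum>i\<in>?I. d i * v i k)"
        using i0 Suc.prems by (subst sum.remove[of I i0]) auto
      also have "(\<Sum>i\<in>?I. d i * v i k) = (\<Sum>i\<in>?I. c i * (v i0 n * v i k))"
        by (intro sum.cong) (auto simp: d_def mult.assoc)
      finally show ?thesis
        by (simp add: d_def w_def right_diff_distrib sum_subtractf sum_distrib_right mult.assoc)
    qed
    have "\<exists>i\<in>I. d i \<notin> P" using c(1) i0 ring_prime_ideal_mult[OF P] by (auto simp: d_def)
    moreover have "(\<Sum>i\<in>I. d i * v i k) \<in> P" if "k < Suc n" for k
    proof (cases "k = n")
      case True
      have "w i n = 0" for i by (simp add: w_def)
      then show ?thesis using True sum_d ring_ideal_0[OF PI] by simp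
    next
      case False
      then show ?thesis using that c(2)[of k] sum_d by simp
    qed
    ultimately show ?thesis by blast
  qed
qed

text \<open>The determinant is formed over the polynomial ring, and evaluation at \<open>s\<close>
  is a ring homomorphism. This lets values at small \<open>s\<close> determine the value at
  \<open>s = 1\<close>.\<close>

lemma det_linear_poly:
  fixes Z :: "'a::comm_ring_1 mat"
  assumes Z: "Z \<in> carrier_mat n n"
  shows "\<exists>f. \<forall>s. poly f s = det (c \<cdot>\<^sub>m 1\<^sub>m n - s \<cdot>\<^sub>m Z)"
proof -
  let ?F = "mat n n (\<lambda>ij. [:c * 1\<^sub>m n $$ ij, - Z $$ ij:])"
  have "poly (det ?F) s = det (c \<cdot>\<^sub>m 1\<^sub>m n - s \<cdot>\<^sub>m Z)" for s
  proof -
    interpret ev: comm_ring_hom "\<lambda>f. poly f s" by unfold_locales auto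
    have "map_mat (\<lambda>f. poly f s) ?F = c \<cdot>\<^sub>m 1\<^sub>m n - s \<cdot>\<^sub>m Z"
      using Z by (intro eq_matI) auto
    then show ?thesis using ev.hom_det[of ?F] by simp
  qed
  then show ?thesis by blast
qed

section \<open>Groups with constant characteristic polynomial\<close>

text \<open>Pairs consisting of the value of an element \<open>\<Sum> a\<^sub>i [g\<^sub>i]\<close> of the group algebra, with coefficients in
  \<open>J\<close>, and its augmentation \<open>\<Sum> a\<^sub>i\<close>.\<close>

inductive_set aug_span :: "nat \<Rightarrow> 'a::comm_ring_1 mat set \<Rightarrow> 'a set \<Rightarrow> ('a mat \<times> 'a) set"
  for n H J where
  zero: "(0\<^sub>m n n, 0) \<in> aug_span n H J"
| add: "(Z, z) \<in> aug_span n H J \<Longrightarrow> a \<in> J \<Longrightarrow> g \<in> H \<Longrightarrow> (Z + a \<cdot>\<^sub>m g, z + a) \<in> aug_span n H J"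

locale mat_monoid =
  fixes n :: nat and H :: "'a::comm_ring_1 mat set"
  assumes H_carrier: "H \<subseteq> carrier_mat n n"
    and H_one: "1\<^sub>m n \<in> H"
    and H_mult: "g \<in> H \<Longrightarrow> h \<in> H \<Longrightarrow> g * h \<in> H"
begin

abbreviation "span_over \<equiv> aug_span n H"

lemma H_mat: "g \<in> H \<Longrightarrow> g \<in> carrier_mat n n"
  using H_carrier by blast

lemma span_carrier: "(Z, z) \<in> span_over J \<Longrightarrow> Z \<in> carrier_mat n n"
  by (induction rule: aug_span.induct) (auto dest: H_mat)

lemma span_mono: "(Z, z) \<in> span_over J \<Longrightarrow> J \<subseteq> J' \<Longrightarrow> (Z, z) \<in> span_over J'"
  by (induction rule: aug_span.induct) (auto intro: aug_span.intros)

lemma span_plus: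
  assumes "(Y, y) \<in> span_over J" "(Z, z) \<in> span_over J"
  shows "(Z + Y, z + y) \<in> span_over J"
  using assms(1)
proof (induction rule: aug_span.induct)
  case zero
  then show ?case using assms(2) span_carrier[OF assms(2)] by simp
next
  case (add Y y a g)
  have "Z + (Y + a \<cdot>\<^sub>m g) = Z + Y + a \<cdot>\<^sub>m g"
    using span_carrier[OF assms(2)] span_carrier[OF add(1)] H_mat[OF add(3)]
    by (simp add: assoc_add_mat[of _ n n])
  then show ?case using aug_span.add[OF add.IH add(2,3)] by (simp add: add.assoc)
qed

lemma span_gen:
  assumes "a \<in> J" "g \<in> H"
  shows "(a \<cdot>\<^sub>m g, a) \<in> span_over J"
  using aug_span.add[OF aug_span.zero[of n H J] assms] H_mat[OF assms(2)] by simp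

lemma span_mult_left:
  assumes "(Z, z) \<in> span_over J" "g \<in> H" "\<And>x. x \<in> J \<Longrightarrow> a * x \<in> J'"
  shows "((a \<cdot>\<^sub>m g) * Z, a * z) \<in> span_over J'"
  using assms(1)
proof (induction rule: aug_span.induct)
  case zero
  have "(a \<cdot>\<^sub>m g) * 0\<^sub>m n n = 0\<^sub>m n n" using H_mat[OF assms(2)] by simp
  then show ?case using aug_span.zero by simp
next
  case (add Z z b h)
  have "(a \<cdot>\<^sub>m g) * (Z + b \<cdot>\<^sub>m h) = (a \<cdot>\<^sub>m g) * Z + (a * b) \<cdot>\<^sub>m (g * h)"
    using span_carrier[OF add(1)] H_mat[OF add(3)] H_mat[OF assms(2)]
    by (simp add: square_mat_simps[where n = n] smult_smult_mat mult.commute)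
  then show ?case
    using aug_span.add[OF add.IH assms(3)[OF add(2)] H_mult[OF assms(2) add(3)]]
    by (simp add: algebra_simps)
qed

lemma span_mult:
  assumes "(Y, y) \<in> span_over UNIV" "(Z, z) \<in> span_over UNIV"
  shows "(Y * Z, y * z) \<in> span_over UNIV"
  using assms(1)
proof (induction rule: aug_span.induct)
  case zero
  then show ?case using aug_span.zero span_carrier[OF assms(2)] by simp
next
  case (add Y y a g)
  have "(Y + a \<cdot>\<^sub>m g) * Z = Y * Z + (a \<cdot>\<^sub>m g) * Z"
    using span_carrier[OF add(1)] H_mat[OF add(3)] span_carrier[OF assms(2)]
    by (simp add: add_mult_distrib_mat[of _ n n _ _ n])
  then show ?case
    using span_plus[OF span_mult_left[OF assms(2) add(3)] add.IH] by (simp add: algebra_simps)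
qed

lemma span_smult:
  assumes "(Z, z) \<in> span_over J" "\<And>x. x \<in> J \<Longrightarrow> a * x \<in> J'"
  shows "(a \<cdot>\<^sub>m Z, a * z) \<in> span_over J'"
proof -
  have "(a \<cdot>\<^sub>m 1\<^sub>m n) * Z = a \<cdot>\<^sub>m Z"
    using span_carrier[OF assms(1)] by (simp add: square_mat_simps[where n = n])
  then show ?thesis using span_mult_left[OF assms(1) H_one assms(2)] by simp
qed

lemma span_minus_one: "g \<in> H \<Longrightarrow> (g - 1\<^sub>m n, 0) \<in> span_over UNIV"
proof -
  assume g: "g \<in> H"
  have "1 \<cdot>\<^sub>m g + (-1) \<cdot>\<^sub>m 1\<^sub>m n = g - 1\<^sub>m n"
    using H_mat[OF g] by (intro eq_matI) auto
  then show ?thesis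
    using span_plus[OF span_gen[OF _ H_one, of "-1"] span_gen[OF _ g, of 1]] by simp
qed

text \<open>Applying the truncated inverse of \<open>1 - a g\<close> keeps the coefficients in the
  ideal \<open>J\<close> and multiplies the augmentation by the corresponding scalar geometric
  sum.\<close>

lemma span_geo_mult:
  assumes S: "(S, s) \<in> span_over J" and J: "ring_ideal J" and g: "g \<in> H"
  shows "(geo_mat n (a \<cdot>\<^sub>m g) k * S, (\<Sum>i<k. a ^ i) * s) \<in> span_over J"
proof (induction k)
  case 0
  then show ?case using aug_span.zero span_carrier[OF S] by simp
next
  case (Suc k)
  let ?x = "a \<cdot>\<^sub>m g" and ?G = "geo_mat n (a \<cdot>\<^sub>m g) k"
  have x: "?x \<in> carrier_mat n n" using H_mat[OF g] by simp
  have "geo_mat n ?x (Suc k) * S = S + ?x * (?G * S)"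
    using x geo_mat_carrier[OF x, of k] span_carrier[OF S]
    by (simp add: add_mult_distrib_mat[of _ n n _ _ n] assoc_mult_mat[of _ n n _ n _ n])
  moreover have "(\<Sum>i<Suc k. a ^ i) * s = s + a * ((\<Sum>i<k. a ^ i) * s)"
    unfolding sum.lessThan_Suc_shift by (simp add: sum_distrib_left algebra_simps)
  ultimately show ?case
    using span_plus[OF span_mult_left[OF Suc g, of a J] S] ring_ideal_mult_left[OF J] by simp
qed

end

context complete_local
begin

text \<open>An identity theorem: the points \<open>c * t ^ Suc i\<close> are nonzero modulo
  \<open>P\<close> and converge to \<open>0\<close>. The constant coefficient is the limit of the
  values, hence in the closed ideal \<open>P\<close>; dividing the rest by the point leaves a
  shorter polynomial with the same property.\<close>

lemma poly_vanish_mod_prime: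
  assumes P: "ring_prime_ideal P" and t: "t \<in> M 1" "t \<notin> P" and c: "c \<notin> P"
    and f: "\<And>i. poly f (c * t ^ Suc i) \<in> P"
  shows "poly f s \<in> P"
  using f
proof (induction f)
  case 0
  then show ?case using ring_prime_ideal_ideal[OF P] by (simp add: ring_ideal_0)
next
  case (pCons b f)
  note PI = ring_prime_ideal_ideal[OF P]
  have x: "c * t ^ Suc i \<notin> P" for i
    using c t ring_prime_ideal_mult[OF P] ring_prime_ideal_power[OF P] by blast
  have "b \<in> ideal_add P (M k)" for k
  proof (rule ideal_add_minusI[OF M_ideal pCons.prems[of k]])
    have "c * t ^ Suc k \<in> M k"
      using power_in_M[OF t(1), of "Suc k"] M_Suc ring_ideal_mult_left[OF M_ideal] by blast
    then show "b - poly (pCons b f) (c * t ^ Suc k) \<in> M k"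
      using ring_ideal_uminus[OF M_ideal] ring_ideal_mult_right[OF M_ideal] by simp
  qed
  then have b: "b \<in> P" by (rule ideal_closed[OF PI])
  have "poly f (c * t ^ Suc i) \<in> P" for i
  proof -
    have "c * t ^ Suc i * poly f (c * t ^ Suc i) \<in> P"
      using ring_ideal_minus[OF PI pCons.prems[of i] b] by simp
    then show ?thesis using x ring_prime_ideal_mult[OF P] by blast
  qed
  then have "poly f s \<in> P" by (rule pCons.IH)
  then show ?case using b by (simp add: ring_ideal_add[OF PI] ring_ideal_mult_left[OF PI])
qed

end

section \<open>Determinants on the span, and vectors modulo a prime\<close>

definition vec_in :: "nat \<Rightarrow> 'a::comm_ring_1 set \<Rightarrow> 'a vec \<Rightarrow> bool" where
  "vec_in n I v \<longleftrightarrow> v \<in> carrier_vec n \<and> (\<forall>k<n. v $ k \<in> I)"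

lemma smult_mat_mult_vec:
  fixes A :: "'a::comm_ring_1 mat"
  assumes "A \<in> carrier_mat n m" "v \<in> carrier_vec m"
  shows "(a \<cdot>\<^sub>m A) *\<^sub>v v = a \<cdot>\<^sub>v (A *\<^sub>v v)"
  using assms by (intro eq_vecI) (auto simp: scalar_prod_def sum_distrib_left mult.assoc)

lemma vec_in_mult_mat:
  assumes "ring_ideal I" "vec_in n I v" "A \<in> carrier_mat n n"
  shows "vec_in n I (A *\<^sub>v v)"
  using assms unfolding vec_in_def
  by (auto simp: scalar_prod_def intro!: ring_ideal_sum ring_ideal_mult_left)

primrec iter_minus_one :: "nat \<Rightarrow> (nat \<Rightarrow> 'a::comm_ring_1 mat) \<Rightarrow> 'a vec \<Rightarrow> nat \<Rightarrow> 'a vec" where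
  "iter_minus_one n g v 0 = v"
| "iter_minus_one n g v (Suc i) = (g i - 1\<^sub>m n) *\<^sub>v iter_minus_one n g v i"

text \<open>\<open>det_gen\<close> is what torsion of \<open>p\<close>-power order provides.
  Multiplication by powers of \<open>t\<close> moves arbitrary coefficients into \<open>M 1\<close>
  without killing anything modulo \<open>P\<close>.\<close>

locale unipotent_mod_prime = complete_local M p + mat_monoid n H
  for M :: "nat \<Rightarrow> 'a::comm_ring_1 set" and p n :: nat and H :: "'a mat set" +
  fixes P :: "'a set" and t :: 'a
  assumes P_prime: "ring_prime_ideal P"
    and t: "t \<in> M 1" "t \<notin> P"
    and det_gen: "g \<in> H \<Longrightarrow> a \<in> M 1 \<Longrightarrow> det (1\<^sub>m n - a \<cdot>\<^sub>m g) - (1 - a) ^ n \<in> P"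
begin

lemma P_ideal: "ring_ideal P"
  using P_prime by (rule ring_prime_ideal_ideal)

text \<open>Descending induction on \<open>d\<close>; at \<open>d = N\<close> both terms are
  \<open>1\<close> modulo \<open>M N\<close>. A term \<open>a g\<close> with
  \<open>a \<in> M d\<close> is split off as a factor \<open>1 - a g\<close>, at the cost of a
  correction with coefficients in \<open>M (Suc d)\<close>. Working modulo \<open>M N\<close> makes
  a finite geometric sum suffice.\<close>

lemma det_span_approx:
  assumes "1 \<le> d" "d \<le> N" "(Z, z) \<in> span_over (M d)"
  shows "det (1\<^sub>m n - Z) - (1 - z) ^ n \<in> ideal_add P (M N)"
  using assms(2,1,3)
proof (induction arbitrary: Z z rule: inc_induct)
  case base
  have "mat_cong n (M N) Z (0\<^sub>m n n) \<and> z \<in> M N"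
    using base(2)
  proof (induction rule: aug_span.induct)
    case zero
    then show ?case by (simp add: mat_cong_refl M_ideal ring_ideal_0)
  next
    case (add Z z a g)
    have "mat_cong n (M N) (Z + a \<cdot>\<^sub>m g) (0\<^sub>m n n + 0 \<cdot>\<^sub>m g)"
      using add H_mat by (intro mat_cong_add mat_cong_smult mat_cong_refl M_ideal) auto
    moreover have "0\<^sub>m n n + 0 \<cdot>\<^sub>m g = 0\<^sub>m n n"
      using H_mat[OF add(3)] by (intro eq_matI) auto
    ultimately show ?case using add M_ideal ring_ideal_add by auto
  qed
  then have Z: "mat_cong n (M N) Z (0\<^sub>m n n)" and z: "z \<in> M N" by auto
  have "mat_cong n (M N) (1\<^sub>m n - Z) (1\<^sub>m n - 0\<^sub>m n n)"
    by (intro mat_cong_minus mat_cong_refl M_ideal Z) simp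
  moreover have "1\<^sub>m n - 0\<^sub>m n n = (1\<^sub>m n :: 'a mat)" by (intro eq_matI) auto
  ultimately have "det (1\<^sub>m n - Z) - 1 \<in> M N"
    using det_cong[OF M_ideal] by fastforce
  moreover have "1 - (1 - z) ^ n \<in> M N"
    using ring_ideal_power_cong[OF M_ideal, of 1 "1 - z" N n] z by simp
  ultimately have "det (1\<^sub>m n - Z) - (1 - z) ^ n \<in> M N"
    by (rule ring_ideal_minus_trans[OF M_ideal])
  then show ?case by (rule ideal_add_right[OF P_ideal])
next
  case (step d)
  let ?I = "ideal_add P (M N)"
  have I: "ring_ideal ?I" by (intro ring_ideal_ideal_add P_ideal M_ideal)
  have MI: "x \<in> M N \<Longrightarrow> x \<in> ?I" for x by (rule ideal_add_right[OF P_ideal])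
  have PI: "x \<in> P \<Longrightarrow> x \<in> ?I" for x by (rule ideal_add_left[OF M_ideal])
  \<comment> \<open>\<open>Z\<close> collects the terms still to be split off and \<open>Z'\<close>
    those with coefficients in \<open>M (Suc d)\<close>. The induction runs over the terms of
    \<open>Z\<close> with \<open>Z'\<close> arbitrary, since each correction is absorbed into
    \<open>Z'\<close>.\<close>
  have "det (1\<^sub>m n - (Z + Z')) - (1 - (z + z')) ^ n \<in> ?I"
    if "(Z, z) \<in> span_over (M d)" "(Z', z') \<in> span_over (M (Suc d))" for Z z Z' z'
    using that
  proof (induction arbitrary: Z' z' rule: aug_span.induct)
    case zero
    then show ?case using step.IH[of Z' z'] span_carrier[OF zero] by simp
  next
    case (add Z z a g)
    define x where "x = a \<cdot>\<^sub>m g"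
    define S where "S = Z + Z'"
    define s where "s = z + z'"
    \<comment> \<open>Chosen so that \<open>S + W\<close> is \<open>geo_mat n x (Suc N) * S\<close>,
      that is \<open>(1 - x)\<^sup>-\<^sup>1 S\<close> up to \<open>x ^ Suc N\<close>. The leading
      factor \<open>x\<close> raises the level of \<open>W\<close> to \<open>Suc d\<close>.\<close>
    define W where "W = x * (geo_mat n x N * S)"
    define w where "w = a * ((\<Sum>i<N. a ^ i) * s)"
    have aM1: "a \<in> M 1" using add(2) M_antimono[OF step.prems(1)] by blast
    have gc: "g \<in> carrier_mat n n" using H_mat[OF add(3)] .
    have S: "(S, s) \<in> span_over (M d)"
      unfolding S_def s_def by (rule span_plus[OF span_mono[OF add.prems M_Suc] add(1)])
    have W: "(W, w) \<in> span_over (M (Suc d))"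
      unfolding W_def w_def x_def
      by (rule span_mult_left[OF span_geo_mult[OF S M_ideal add(3)] add(3)])
        (use M_mult[OF aM1] in auto)
    have c: "x \<in> carrier_mat n n" "S \<in> carrier_mat n n" "W \<in> carrier_mat n n"
        "Z \<in> carrier_mat n n" "Z' \<in> carrier_mat n n"
      using gc span_carrier[OF S] span_carrier[OF W] span_carrier[OF add(1)]
        span_carrier[OF add.prems] by (auto simp: x_def)
    have SW: "S + W = geo_mat n x (Suc N) * S"
      using c by (simp add: W_def square_mat_simps[where n = n])
    have "(1\<^sub>m n - x) * (1\<^sub>m n - (S + W)) = (1\<^sub>m n - x) - ((1\<^sub>m n - x) * geo_mat n x (Suc N)) * S"
    proof -
      let ?G = "geo_mat n x (Suc N)"
      have G: "?G \<in> carrier_mat n n" "?G * S \<in> carrier_mat n n" and x: "1\<^sub>m n - x \<in> carrier_mat n n"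
        using c geo_mat_carrier[OF c(1), of "Suc N"] by (auto simp del: geo_mat.simps)
      show ?thesis
        unfolding SW mult_minus_distrib_mat[OF x one_carrier_mat G(2)] assoc_mult_mat[OF x G(1) c(2)]
          right_mult_one_mat[OF x] ..
    qed
    also have "\<dots> = (1\<^sub>m n - x) - (S - x ^\<^sub>m Suc N * S)"
      unfolding one_minus_mult_geo_mat[OF c(1)]
      using c pow_carrier_mat[OF c(1), of "Suc N"]
      by (simp add: minus_mult_distrib_mat[of _ n n _ _ n] del: pow_mat.simps)
    finally have prod: "(1\<^sub>m n - x) * (1\<^sub>m n - (S + W)) = (1\<^sub>m n - x) - (S - x ^\<^sub>m Suc N * S)" .
    have aN: "a ^ Suc N \<in> M N" using power_in_M[OF aM1, of "Suc N"] M_Suc by blast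
    have "mat_cong n (M N) (x ^\<^sub>m Suc N * S) (0\<^sub>m n n)"
      unfolding x_def smult_pow_mat[OF gc] mat_cong_def
    proof (intro conjI allI impI)
      fix i j assume ij: "i < n" "j < n"
      have gs: "g ^\<^sub>m Suc N \<in> carrier_mat n n" "g ^\<^sub>m Suc N * S \<in> carrier_mat n n"
        using gc c by auto
      have "(a ^ Suc N \<cdot>\<^sub>m (g ^\<^sub>m Suc N) * S) $$ (i, j) = a ^ Suc N * (g ^\<^sub>m Suc N * S) $$ (i, j)"
        unfolding mult_smult_assoc_mat[OF gs(1) c(2)]
        using carrier_matD[OF gs(2)] ij by (simp del: pow_mat.simps power_Suc)
      then show "(a ^ Suc N \<cdot>\<^sub>m (g ^\<^sub>m Suc N) * S) $$ (i, j) - 0\<^sub>m n n $$ (i, j) \<in> M N"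
        using ring_ideal_mult_right[OF M_ideal aN] ij by (simp del: pow_mat.simps power_Suc)
    qed (use gc c in auto)
    then have "mat_cong n (M N) ((1\<^sub>m n - x) * (1\<^sub>m n - (S + W))) ((1\<^sub>m n - x) - (S - 0\<^sub>m n n))"
      unfolding prod using c by (intro mat_cong_minus mat_cong_refl M_ideal) auto
    moreover have "(1\<^sub>m n - x) - (S - 0\<^sub>m n n) = 1\<^sub>m n - (Z + a \<cdot>\<^sub>m g + Z')"
      using c gc by (intro eq_matI) (auto simp: S_def x_def)
    ultimately have "det ((1\<^sub>m n - x) * (1\<^sub>m n - (S + W))) - det (1\<^sub>m n - (Z + a \<cdot>\<^sub>m g + Z')) \<in> M N"
      using det_cong[OF M_ideal] by metis
    then have 1: "det (1\<^sub>m n - (Z + a \<cdot>\<^sub>m g + Z')) - det (1\<^sub>m n - x) * det (1\<^sub>m n - (S + W)) \<in> ?I"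
      using c by (simp add: det_mult[of _ n] ring_ideal_minus_commute[OF M_ideal] MI)
    have "Z + (Z' + W) = S + W"
      using c by (simp add: S_def assoc_add_mat[of _ n n])
    then have "det (1\<^sub>m n - (S + W)) - (1 - (s + w)) ^ n \<in> ?I"
      using add.IH[OF span_plus[OF W add.prems]] by (simp add: s_def add.assoc)
    moreover have "det (1\<^sub>m n - x) - (1 - a) ^ n \<in> ?I"
      unfolding x_def by (intro PI det_gen add aM1)
    ultimately have 2: "det (1\<^sub>m n - x) * det (1\<^sub>m n - (S + W)) - (1 - a) ^ n * (1 - (s + w)) ^ n \<in> ?I"
      by (intro ring_ideal_mult_cong I)
    \<comment> \<open>The augmentations satisfy the same factorization, with the same kind of error
      term.\<close>
    have "(1 - a) * (1 - (s + w)) - (1 - (z + a + z')) = s * a ^ Suc N"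
    proof -
      have "s + w = (\<Sum>i<Suc N. a ^ i) * s"
        unfolding w_def sum.lessThan_Suc_shift by (simp add: sum_distrib_left algebra_simps)
      then have "(1 - a) * (1 - (s + w)) = (1 - a) - ((1 - a) * (\<Sum>i<Suc N. a ^ i)) * s"
        by (simp add: algebra_simps)
      also have "(1 - a) * (\<Sum>i<Suc N. a ^ i) = 1 - a ^ Suc N" by (rule one_diff_power_eq[symmetric])
      finally show ?thesis by (simp add: s_def algebra_simps)
    qed
    then have "(1 - a) * (1 - (s + w)) - (1 - (z + a + z')) \<in> M N"
      using ring_ideal_mult_left[OF M_ideal aN] by simp
    from ring_ideal_power_cong[OF I MI[OF this], of n]
    have 3: "(1 - a) ^ n * (1 - (s + w)) ^ n - (1 - (z + a + z')) ^ n \<in> ?I"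
      by (simp add: power_mult_distrib)
    show ?case
      using ring_ideal_minus_trans[OF I 1 ring_ideal_minus_trans[OF I 2 3]] .
  qed
  from this[OF step.prems(2) aug_span.zero] span_carrier[OF step.prems(2)]
  show ?case by simp
qed

text \<open>The approximations hold modulo \<open>P\<close> and \<open>M N\<close> for every
  \<open>N \<ge> 1\<close>, and \<open>P\<close> is closed.\<close>

lemma det_span:
  assumes "(Z, z) \<in> span_over (M 1)"
  shows "det (1\<^sub>m n - Z) - (1 - z) ^ n \<in> P"
proof (rule ideal_closed[OF P_ideal])
  fix k
  have "det (1\<^sub>m n - Z) - (1 - z) ^ n \<in> ideal_add P (M (Suc k))"
    using det_span_approx[of 1 "Suc k" Z z] assms by simp
  then show "det (1\<^sub>m n - Z) - (1 - z) ^ n \<in> ideal_add P (M k)"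
    using M_Suc unfolding ideal_add_def by blast
qed

text \<open>The determinant is even \<open>c ^ n\<close> modulo \<open>P\<close>. By
  \<open>det_span\<close>, \<open>det (c - s Z)\<close> takes this value at every
  \<open>s = c * t ^ Suc i\<close>; as it is a polynomial in \<open>s\<close>, it also does so at
  \<open>s = 1\<close>.\<close>

lemma det_augmentation_zero:
  assumes Z: "(Z, 0) \<in> span_over UNIV" and c: "c \<notin> P"
  shows "det (c \<cdot>\<^sub>m 1\<^sub>m n - Z) \<notin> P"
proof -
  have Zc: "Z \<in> carrier_mat n n" using Z by (rule span_carrier)
  obtain f where f: "\<And>s. poly f s = det (c \<cdot>\<^sub>m 1\<^sub>m n - s \<cdot>\<^sub>m Z)"
    using det_linear_poly[OF Zc] by blast
  have "poly (f - [:c ^ n:]) 1 \<in> P"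
  proof (rule poly_vanish_mod_prime[OF P_prime t c])
    fix i
    define a where "a = t ^ Suc i"
    have a: "a \<in> M 1"
      using ring_ideal_mult_right[OF M_ideal t(1)] by (simp add: a_def)
    have "(a \<cdot>\<^sub>m Z, a * 0) \<in> span_over (M 1)"
      by (rule span_smult[OF Z]) (use ring_ideal_mult_right[OF M_ideal a] in auto)
    from det_span[OF this] have "det (1\<^sub>m n - a \<cdot>\<^sub>m Z) - 1 \<in> P" by simp
    moreover have "c \<cdot>\<^sub>m 1\<^sub>m n - (c * a) \<cdot>\<^sub>m Z = c \<cdot>\<^sub>m (1\<^sub>m n - a \<cdot>\<^sub>m Z)"
      using Zc by (intro eq_matI) (auto simp: algebra_simps)
    then have "poly (f - [:c ^ n:]) (c * a) = c ^ n * (det (1\<^sub>m n - a \<cdot>\<^sub>m Z) - 1)"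
      using Zc by (simp add: f algebra_simps)
    ultimately show "poly (f - [:c ^ n:]) (c * t ^ Suc i) \<in> P"
      unfolding a_def[symmetric] by (simp add: ring_ideal_mult_left[OF P_ideal])
  qed
  moreover have "1 \<cdot>\<^sub>m Z = Z" using Zc by (intro eq_matI) auto
  ultimately have "det (c \<cdot>\<^sub>m 1\<^sub>m n - Z) - c ^ n \<in> P" by (simp add: f)
  moreover have "c ^ n \<notin> P" using c ring_prime_ideal_power[OF P_prime] by blast
  ultimately show ?thesis using ring_ideal_mem_cong[OF P_ideal] by blast
qed

text \<open>Multiplication by the adjugate leaves \<open>v\<close> scaled by a determinant outside
  \<open>P\<close>.\<close>

lemma no_eigenvalue:
  assumes Z: "(Z, 0) \<in> span_over UNIV" and c: "c \<notin> P" and v: "v \<in> carrier_vec n"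
    and eig: "vec_in n P ((c \<cdot>\<^sub>m 1\<^sub>m n - Z) *\<^sub>v v)"
  shows "vec_in n P v"
proof -
  let ?A = "c \<cdot>\<^sub>m 1\<^sub>m n - Z"
  have A: "?A \<in> carrier_mat n n" using span_carrier[OF Z] by simp
  have "vec_in n P (adj_mat ?A *\<^sub>v (?A *\<^sub>v v))"
    by (rule vec_in_mult_mat[OF P_ideal eig adj_mat(1)[OF A]])
  also have "adj_mat ?A *\<^sub>v (?A *\<^sub>v v) = (adj_mat ?A * ?A) *\<^sub>v v"
    using assoc_mult_mat_vec[OF adj_mat(1)[OF A] A v] by simp
  also have "\<dots> = det ?A \<cdot>\<^sub>v v"
    unfolding adj_mat(3)[OF A] using v by (intro eq_vecI) (auto simp: smult_mat_mult_vec[of _ n n])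
  finally have "vec_in n P (det ?A \<cdot>\<^sub>v v)" .
  then show ?thesis
    using det_augmentation_zero[OF Z c] ring_prime_ideal_mult[OF P_prime] v
    unfolding vec_in_def by auto
qed

lemma iter_minus_one_carrier:
  "(\<And>i. g i \<in> H) \<Longrightarrow> v \<in> carrier_vec n \<Longrightarrow> iter_minus_one n g v i \<in> carrier_vec n"
  by (induction i) (auto intro!: mult_mat_vec_carrier[of _ n n] simp: H_mat)

text \<open>Otherwise the \<open>n + 1\<close> iterates are nonzero modulo \<open>P\<close>. They are linearly dependent, and the first
  one with a nonzero coefficient \<open>c\<close> is an eigenvector, for the eigenvalue \<open>c\<close>, of an element of
  augmentation \<open>0\<close>, because the later iterates are images of it under such elements.\<close>

lemma iter_minus_one_vanishes:
  assumes g: "\<And>i. g i \<in> H" and v: "v \<in> carrier_vec n"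
  shows "vec_in n P (iter_minus_one n g v n)"
proof -
  let ?w = "iter_minus_one n g v"
  have wc: "?w i \<in> carrier_vec n" for i by (rule iter_minus_one_carrier[OF g v])
  \<comment> \<open>Iterates that vanish modulo \<open>P\<close> stay so; it therefore suffices to
    find one index \<open>m \<le> n\<close> where the iterate vanishes.\<close>
  have later: "vec_in n P (?w j)" if "vec_in n P (?w i)" "i \<le> j" for i j
    using that(2,1)
    by (induction rule: dec_induct) (auto intro!: vec_in_mult_mat P_ideal simp: H_mat g)
  obtain c where c: "\<exists>i\<in>{..n}. c i \<notin> P" "\<And>k. k < n \<Longrightarrow> (\<Sum>i\<in>{..n}. c i * ?w i $ k) \<in> P"
    using linear_dependence_mod_prime[OF P_prime, of "{..n}" n "\<lambda>i k. ?w i $ k"] by auto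
  \<comment> \<open>The terms of the relation before \<open>m\<close> lie in \<open>P\<close>, so
    that \<open>c m * ?w m\<close> is, modulo \<open>P\<close>, minus the sum of the later
    terms.\<close>
  define m where "m = (LEAST i. c i \<notin> P)"
  have m: "c m \<notin> P" "m \<le> n" and below: "\<And>i. i < m \<Longrightarrow> c i \<in> P"
  proof -
    show "c m \<notin> P" unfolding m_def using c(1) LeastI_ex[of "\<lambda>i. c i \<notin> P"] by blast
    obtain i where "i \<le> n" "c i \<notin> P" using c(1) by auto
    then show "m \<le> n" unfolding m_def by (meson Least_le order_trans)
    show "\<And>i. i < m \<Longrightarrow> c i \<in> P" unfolding m_def using not_less_Least by blast
  qed
  have tail: "\<exists>Z. (Z, 0) \<in> span_over UNIV \<and> Z *\<^sub>v ?w m = ?w (m + Suc i)" for i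
  proof (induction i)
    case 0
    show ?case using span_minus_one[OF g[of m]] by (intro exI[of _ "g m - 1\<^sub>m n"]) simp
  next
    case (Suc i)
    then obtain Z where Z: "(Z, 0) \<in> span_over UNIV" "Z *\<^sub>v ?w m = ?w (m + Suc i)" by blast
    let ?Y = "g (m + Suc i) - 1\<^sub>m n"
    have "(?Y * Z, 0) \<in> span_over UNIV"
      using span_mult[OF span_minus_one[OF g] Z(1)] by simp
    moreover have "(?Y * Z) *\<^sub>v ?w m = ?w (m + Suc (Suc i))"
      using assoc_mult_mat_vec[OF _ span_carrier[OF Z(1)] wc, of ?Y n m] Z(2) H_mat[OF g] by simp
    ultimately show ?case by blast
  qed
  \<comment> \<open>The later terms together are the image of \<open>?w m\<close> under one element
    of augmentation \<open>0\<close>, assembled term by term; \<open>l = n - m\<close> gives the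
    whole tail.\<close>
  have "\<exists>Z. (Z, 0) \<in> span_over UNIV \<and>
      (\<forall>k<n. (Z *\<^sub>v ?w m) $ k = - (\<Sum>i\<in>{m<..m + l}. c i * ?w i $ k))" for l
  proof (induction l)
    case 0
    show ?case using aug_span.zero wc[of m] by (intro exI[of _ "0\<^sub>m n n"]) (auto simp: scalar_prod_def)
  next
    case (Suc l)
    then obtain Z where Z: "(Z, 0) \<in> span_over UNIV"
      "\<And>k. k < n \<Longrightarrow> (Z *\<^sub>v ?w m) $ k = - (\<Sum>i\<in>{m<..m + l}. c i * ?w i $ k)" by blast
    obtain Y where Y: "(Y, 0) \<in> span_over UNIV" "Y *\<^sub>v ?w m = ?w (m + Suc l)" using tail by blast
    let ?X = "Z + (- c (m + Suc l)) \<cdot>\<^sub>m Y"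
    have Yc: "Y \<in> carrier_mat n n" and Zc: "Z \<in> carrier_mat n n"
      using Y Z by (auto dest: span_carrier)
    have "(?X, 0) \<in> span_over UNIV"
      using span_plus[OF span_smult[OF Y(1), of "- c (m + Suc l)" UNIV] Z(1)] by simp
    moreover have "(?X *\<^sub>v ?w m) $ k = - (\<Sum>i\<in>{m<..m + Suc l}. c i * ?w i $ k)" if "k < n" for k
    proof -
      have "(?X *\<^sub>v ?w m) $ k = (Z *\<^sub>v ?w m) $ k - c (m + Suc l) * (Y *\<^sub>v ?w m) $ k"
        using Yc Zc wc[of m] that
        by (simp add: add_mult_distrib_mat_vec[of _ n n] smult_mat_mult_vec[of _ n n])
      moreover have "{m<..m + Suc l} = insert (m + Suc l) {m<..m + l}" by auto
      ultimately show ?thesis using Z(2)[OF that] Y(2) by simp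
    qed
    ultimately show ?case by blast
  qed
  from this[of "n - m"] m obtain Z where Z: "(Z, 0) \<in> span_over UNIV"
    "\<And>k. k < n \<Longrightarrow> (Z *\<^sub>v ?w m) $ k = - (\<Sum>i\<in>{m<..n}. c i * ?w i $ k)" by auto
  have "vec_in n P ((c m \<cdot>\<^sub>m 1\<^sub>m n - Z) *\<^sub>v ?w m)"
    unfolding vec_in_def
  proof (intro conjI allI impI)
    fix k assume k: "k < n"
    have "((c m \<cdot>\<^sub>m 1\<^sub>m n - Z) *\<^sub>v ?w m) $ k = c m * ?w m $ k + (\<Sum>i\<in>{m<..n}. c i * ?w i $ k)"
      using span_carrier[OF Z(1)] wc[of m] Z(2)[OF k] k
      by (simp add: minus_mult_distrib_mat_vec[of _ n n] smult_mat_mult_vec[of _ n n])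
    also have "\<dots> = (\<Sum>i\<in>{..n}. c i * ?w i $ k) - (\<Sum>i<m. c i * ?w i $ k)"
    proof -
      have "{..n} = {..<m} \<union> insert m {m<..n}" using m(2) by auto
      then have "(\<Sum>i\<in>{..n}. c i * ?w i $ k) = (\<Sum>i<m. c i * ?w i $ k) + (\<Sum>i\<in>insert m {m<..n}. c i * ?w i $ k)"
        by (simp only:) (subst sum.union_disjoint, auto)
      then show ?thesis by simp
    qed
    also have "\<dots> \<in> P"
      by (rule ring_ideal_minus[OF P_ideal c(2)[OF k]])
        (auto intro!: ring_ideal_sum ring_ideal_mult_right P_ideal below)
    finally show "((c m \<cdot>\<^sub>m 1\<^sub>m n - Z) *\<^sub>v ?w m) $ k \<in> P" .
  qed (use span_carrier[OF Z(1)] wc[of m] in \<open>auto intro!: mult_mat_vec_carrier[of _ n n]\<close>)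
  from no_eigenvalue[OF Z(1) m(1) wc this] show ?thesis by (rule later[OF _ m(2)])
qed

end

section \<open>Congruence subgroups and commutators\<close>

lemma GL_simps:
  "mult (GL n) = (*)" "one (GL n) = (1\<^sub>m n :: 'a::comm_ring_1 mat)"
  by (simp_all add: GL_def units_of_def ring_mat_simps)

lemma GL_carrierD:
  fixes g :: "'a::comm_ring_1 mat"
  shows "g \<in> carrier (GL n) \<Longrightarrow> g \<in> carrier_mat n n"
  by (auto simp: GL_def units_of_def Units_def ring_mat_simps)

lemma group_GL: "group (GL n :: 'a::comm_ring_1 mat monoid)"
proof -
  interpret R: ring "ring_mat TYPE('a) n ()" by (rule ring_mat)
  show ?thesis unfolding GL_def by (rule R.units_group)
qed

lemma GL_pow: "(g :: 'a::comm_ring_1 mat) \<in> carrier (GL n) \<Longrightarrow> g [^]\<^bsub>GL n\<^esub> (k::nat) = g ^\<^sub>m k"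
proof (induction k)
  case 0
  then show ?case using GL_carrierD[OF 0] by (simp add: GL_simps nat_pow_def)
next
  case (Suc k)
  then show ?case by (simp add: GL_simps nat_pow_def)
qed

lemma pow_mat_mult:
  assumes X: "(X :: 'a::comm_ring_1 mat) \<in> carrier_mat n n"
  shows "(X ^\<^sub>m a) ^\<^sub>m b = X ^\<^sub>m (a * b)"
proof -
  interpret R: ring "ring_mat TYPE('a) n ()" by (rule ring_mat)
  have Xa: "X ^\<^sub>m a \<in> carrier_mat n n" using X by simp
  show ?thesis
    unfolding pow_mat_ring_pow[OF Xa, of b "()"] unfolding pow_mat_ring_pow[OF X, of _ "()"]
    using R.nat_pow_pow[of X a b] X by (simp add: ring_mat_simps)
qed

lemma GL_inv:
  fixes g :: "'a::comm_ring_1 mat"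
  assumes "g \<in> carrier (GL n)"
  shows "inv\<^bsub>GL n\<^esub> g \<in> carrier (GL n)" "inv\<^bsub>GL n\<^esub> g \<in> carrier_mat n n"
    "inv\<^bsub>GL n\<^esub> g * g = 1\<^sub>m n" "g * inv\<^bsub>GL n\<^esub> g = 1\<^sub>m n"
proof -
  interpret group "GL n :: 'a mat monoid" by (rule group_GL)
  show "inv\<^bsub>GL n\<^esub> g \<in> carrier (GL n)" using assms by simp
  then show "inv\<^bsub>GL n\<^esub> g \<in> carrier_mat n n" by (rule GL_carrierD)
  show "inv\<^bsub>GL n\<^esub> g * g = 1\<^sub>m n" "g * inv\<^bsub>GL n\<^esub> g = 1\<^sub>m n"
    using l_inv[OF assms] r_inv[OF assms] by (simp_all add: GL_simps)
qed

lemma derived_GL_subset: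
  fixes K :: "'a::comm_ring_1 mat set"
  assumes "subgroup L (GL n)"
    and "\<And>g h. g \<in> K \<Longrightarrow> h \<in> K \<Longrightarrow> g * h * inv\<^bsub>GL n\<^esub> g * inv\<^bsub>GL n\<^esub> h \<in> L"
  shows "derived (GL n) K \<subseteq> L"
proof -
  interpret group "GL n :: 'a mat monoid" by (rule group_GL)
  show ?thesis
    unfolding derived_def
    by (rule generate_subgroup_incl[OF _ assms(1)]) (use assms(2) in \<open>auto simp: GL_simps\<close>)
qed

lemma derived_power_antimono:
  fixes K :: "'a::comm_ring_1 mat set"
  assumes "subgroup K (GL n)" "i \<le> j"
  shows "(derived (GL n) ^^ j) K \<subseteq> (derived (GL n) ^^ i) K"
proof -
  interpret group "GL n :: 'a mat monoid" by (rule group_GL)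
  show ?thesis
    by (rule lift_Suc_antimono_le[OF _ assms(2), of "\<lambda>i. (derived (GL n) ^^ i) K"])
      (use derived_incl[OF subset_refl exp_of_derived_is_subgroup[OF assms(1)]] in auto)
qed

definition cong_subgroup :: "nat \<Rightarrow> 'a::comm_ring_1 set \<Rightarrow> 'a mat set" where
  "cong_subgroup n I = {g \<in> carrier (GL n). mat_cong n I g (1\<^sub>m n)}"

lemma subgroup_cong_subgroup:
  assumes I: "ring_ideal I"
  shows "subgroup (cong_subgroup n I) (GL n)"
proof -
  interpret group "GL n :: 'a mat monoid" by (rule group_GL)
  show ?thesis
  proof (rule subgroupI)
    show "cong_subgroup n I \<subseteq> carrier (GL n)" by (auto simp: cong_subgroup_def)
    have "1\<^sub>m n \<in> cong_subgroup n I"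
      using one_closed by (simp add: cong_subgroup_def mat_cong_refl[OF I] GL_simps)
    then show "cong_subgroup n I \<noteq> {}" by blast
  next
    fix g assume g: "g \<in> cong_subgroup n I"
    then have gc: "g \<in> carrier (GL n)" by (simp add: cong_subgroup_def)
    have "mat_cong n I (inv\<^bsub>GL n\<^esub> g * g) (inv\<^bsub>GL n\<^esub> g * 1\<^sub>m n)"
      using g GL_inv[OF gc] by (intro mat_cong_mult mat_cong_refl I) (auto simp: cong_subgroup_def)
    then show "inv\<^bsub>GL n\<^esub> g \<in> cong_subgroup n I"
      using GL_inv[OF gc] mat_cong_sym[OF I] by (simp add: cong_subgroup_def)
  next
    fix g h assume gh: "g \<in> cong_subgroup n I" "h \<in> cong_subgroup n I"
    then have "mat_cong n I (g * h) (1\<^sub>m n * 1\<^sub>m n)"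
      by (intro mat_cong_mult I) (auto simp: cong_subgroup_def)
    then show "g \<otimes>\<^bsub>GL n\<^esub> h \<in> cong_subgroup n I"
      using gh m_closed[of g h] by (simp add: cong_subgroup_def GL_simps)
  qed
qed

text \<open>Multiply the congruence on the right by the inverses of \<open>g\<close> and
  \<open>h\<close>.\<close>

lemma commutator_in_cong_subgroup:
  assumes I: "ring_ideal I" and g: "g \<in> carrier (GL n)" and h: "h \<in> carrier (GL n)"
    and comm: "mat_cong n I (g * h) (h * g)"
  shows "g * h * inv\<^bsub>GL n\<^esub> g * inv\<^bsub>GL n\<^esub> h \<in> cong_subgroup n I"
proof -
  interpret group "GL n :: 'a mat monoid" by (rule group_GL)
  note c = GL_carrierD[OF g] GL_carrierD[OF h] GL_inv[OF g] GL_inv[OF h]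
  have "mat_cong n I (g * h * inv\<^bsub>GL n\<^esub> g * inv\<^bsub>GL n\<^esub> h) (h * g * inv\<^bsub>GL n\<^esub> g * inv\<^bsub>GL n\<^esub> h)"
    using c by (intro mat_cong_mult mat_cong_refl I comm)
  moreover have "h * g * inv\<^bsub>GL n\<^esub> g * inv\<^bsub>GL n\<^esub> h = 1\<^sub>m n"
  proof -
    have "h * g * inv\<^bsub>GL n\<^esub> g = h"
      unfolding assoc_mult_mat[OF c(2,1,4)] c(6) using c(2) by simp
    then show ?thesis using c by simp
  qed
  moreover have "g * h * inv\<^bsub>GL n\<^esub> g * inv\<^bsub>GL n\<^esub> h \<in> carrier (GL n)"
    using m_closed[OF m_closed[OF m_closed[OF g h] GL_inv(1)[OF g]] GL_inv(1)[OF h]]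
    by (simp add: GL_simps)
  ultimately show ?thesis by (simp add: cong_subgroup_def)
qed

text \<open>Turns noncommutativity into products of two factors of the form \<open>x - 1\<close>.
  Both the step from two ideals to their product and the doubling along the flag rest on it.\<close>

lemma commutator_expand:
  fixes g h :: "'a::comm_ring_1 mat"
  assumes g: "g \<in> carrier_mat n n" and h: "h \<in> carrier_mat n n"
  shows "g * h - h * g = (g - 1\<^sub>m n) * (h - 1\<^sub>m n) - (h - 1\<^sub>m n) * (g - 1\<^sub>m n)"
proof -
  have *: "(g - 1\<^sub>m n) * (h - 1\<^sub>m n) = (g * h - h) - (g - 1\<^sub>m n)"
    if "g \<in> carrier_mat n n" "h \<in> carrier_mat n n" for g h :: "'a mat"
    using that by (simp add: minus_mult_distrib_mat[of _ n n _ _ n] mult_minus_distrib_mat[of _ n n _ n])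
  have gh: "g * h \<in> carrier_mat n n" "h * g \<in> carrier_mat n n" using g h by auto
  show ?thesis
    unfolding *[OF g h] *[OF h g] using g h gh by (intro eq_matI) auto
qed

text \<open>In both products of the expansion of \<open>g * h - h * g\<close>, the first factor is
  taken modulo \<open>I1\<close> and the second modulo \<open>I2\<close>; this is possible because
  \<open>K\<close> is trivial modulo both.\<close>

lemma derived_product_ideal:
  assumes I: "ring_ideal I" "ring_ideal I1" "ring_ideal I2"
    and mult: "\<And>x y. x \<in> I1 \<Longrightarrow> y \<in> I2 \<Longrightarrow> x * y \<in> I"
    and K: "K \<subseteq> cong_subgroup n I1" "K \<subseteq> cong_subgroup n I2"
  shows "derived (GL n) K \<subseteq> cong_subgroup n I"
proof (rule derived_GL_subset[OF subgroup_cong_subgroup[OF I(1)]])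
  fix g h assume g: "g \<in> K" and h: "h \<in> K"
  have gG: "g \<in> carrier (GL n)" and hG: "h \<in> carrier (GL n)"
    and cg: "mat_cong n I1 g (1\<^sub>m n)" "mat_cong n I2 g (1\<^sub>m n)"
    and ch: "mat_cong n I1 h (1\<^sub>m n)" "mat_cong n I2 h (1\<^sub>m n)"
    using g h K by (auto simp: cong_subgroup_def)
  note gc = GL_carrierD[OF gG] and hc = GL_carrierD[OF hG]
  have entry: "((a - 1\<^sub>m n) * (b - 1\<^sub>m n)) $$ (i, j) \<in> I"
    if ab: "mat_cong n I1 a (1\<^sub>m n)" "mat_cong n I2 b (1\<^sub>m n)" and ij: "i < n" "j < n" for a b i j
  proof -
    have c: "a \<in> carrier_mat n n" "b \<in> carrier_mat n n" using ab by (auto dest: mat_congD)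
    have "((a - 1\<^sub>m n) * (b - 1\<^sub>m n)) $$ (i, j) =
        (\<Sum>k<n. (a $$ (i, k) - 1\<^sub>m n $$ (i, k)) * (b $$ (k, j) - 1\<^sub>m n $$ (k, j)))"
      using c ij by (subst mult_mat_entry[of _ n]) (auto intro!: sum.cong)
    also have "\<dots> \<in> I"
      using mat_congD(3)[OF ab(1) ij(1)] mat_congD(3)[OF ab(2) _ ij(2)]
      by (intro ring_ideal_sum I mult) auto
    finally show ?thesis .
  qed
  have "mat_cong n I (g * h) (h * g)"
    unfolding mat_cong_def
  proof (intro conjI allI impI)
    fix i j assume ij: "i < n" "j < n"
    have "(g * h) $$ (i, j) - (h * g) $$ (i, j) = (g * h - h * g) $$ (i, j)"
      using gc hc ij by simp
    also have "\<dots> = ((g - 1\<^sub>m n) * (h - 1\<^sub>m n)) $$ (i, j) - ((h - 1\<^sub>m n) * (g - 1\<^sub>m n)) $$ (i, j)"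
      unfolding commutator_expand[OF gc hc] using gc hc ij by simp
    also have "\<dots> \<in> I"
      by (intro ring_ideal_minus I entry cg ch ij)
    finally show "(g * h) $$ (i, j) - (h * g) $$ (i, j) \<in> I" .
  qed (use gc hc in auto)
  then show "g * h * inv\<^bsub>GL n\<^esub> g * inv\<^bsub>GL n\<^esub> h \<in> cong_subgroup n I"
    by (rule commutator_in_cong_subgroup[OF I(1) gG hG])
qed

text \<open>The ascending series of fixed vectors: modulo stage \<open>k\<close>, the stage
  \<open>Suc k\<close> consists of the vectors fixed by \<open>H\<close>. It starts with the vectors
  that are zero modulo \<open>P\<close>.\<close>

primrec flag :: "nat \<Rightarrow> 'a::comm_ring_1 mat set \<Rightarrow> 'a set \<Rightarrow> nat \<Rightarrow> 'a vec set" where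
  "flag n H P 0 = {v. vec_in n P v}"
| "flag n H P (Suc k) = {v \<in> carrier_vec n. \<forall>g\<in>H. (g - 1\<^sub>m n) *\<^sub>v v \<in> flag n H P k}"

context unipotent_mod_prime
begin

abbreviation "V \<equiv> flag n H P"

lemma flag_carrier: "v \<in> V k \<Longrightarrow> v \<in> carrier_vec n"
  by (cases k) (auto simp: vec_in_def)

lemma flag_minus: "v \<in> V k \<Longrightarrow> w \<in> V k \<Longrightarrow> v - w \<in> V k"
proof (induction k arbitrary: v w)
  case 0
  then show ?case by (auto simp: vec_in_def ring_ideal_minus[OF P_ideal])
next
  case (Suc k)
  then show ?case by (auto simp: mult_minus_distrib_mat_vec[of _ n n] H_mat)
qed

lemma flag_add: "v \<in> V k \<Longrightarrow> w \<in> V k \<Longrightarrow> v + w \<in> V k"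
proof (induction k arbitrary: v w)
  case 0
  then show ?case by (auto simp: vec_in_def ring_ideal_add[OF P_ideal])
next
  case (Suc k)
  then show ?case by (auto simp: mult_add_distrib_mat_vec[of _ n n] H_mat)
qed

lemma flag_Suc: "V k \<subseteq> V (Suc k)"
proof (induction k)
  case 0
  have "(g - 1\<^sub>m n) *\<^sub>v v \<in> V 0" if "g \<in> H" "vec_in n P v" for g v
    using vec_in_mult_mat[OF P_ideal that(2), of "g - 1\<^sub>m n"] H_mat[OF that(1)] by simp
  then show ?case by (auto simp: vec_in_def)
next
  case (Suc k)
  show ?case
  proof
    fix v assume v: "v \<in> V (Suc k)"
    then show "v \<in> V (Suc (Suc k))"
      using Suc by (subst flag.simps(2)) auto
  qed
qed

lemma flag_mono: "i \<le> j \<Longrightarrow> V i \<subseteq> V j"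
  by (rule lift_Suc_mono_le[of V]) (use flag_Suc in auto)

lemma mult_vec_minus_one:
  fixes g :: "'a mat"
  assumes "g \<in> carrier_mat n n" "v \<in> carrier_vec n"
  shows "(g - 1\<^sub>m n) *\<^sub>v v = g *\<^sub>v v - v"
  using assms by (simp add: minus_mult_distrib_mat_vec[of _ n n])

lemma flag_stable:
  assumes v: "v \<in> V k" and g: "g \<in> H"
  shows "g *\<^sub>v v \<in> V k"
proof -
  have "(g - 1\<^sub>m n) *\<^sub>v v \<in> V k" using flag_Suc[of k] v g by auto
  then have "(g *\<^sub>v v - v) + v \<in> V k"
    using flag_add v by (simp add: mult_vec_minus_one[OF H_mat[OF g] flag_carrier[OF v]])
  moreover have "(g *\<^sub>v v - v) + v = g *\<^sub>v v"
    using H_mat[OF g] flag_carrier[OF v] by (intro eq_vecI) auto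
  ultimately show ?thesis by simp
qed

lemma iter_minus_one_shift:
  "iter_minus_one n (case_nat g0 g) v (Suc i) = iter_minus_one n g ((g0 - 1\<^sub>m n) *\<^sub>v v) i"
  by (induction i) auto

text \<open>A vector outside stage \<open>Suc k\<close> is moved by some \<open>g0 - 1\<close>
  outside stage \<open>k\<close>; \<open>case_nat\<close> puts this \<open>g0\<close> in front of
  the sequence for the new vector.\<close>

lemma not_in_flag:
  "v \<in> carrier_vec n \<Longrightarrow> v \<notin> V k \<Longrightarrow> \<exists>g. (\<forall>i. g i \<in> H) \<and> \<not> vec_in n P (iter_minus_one n g v k)"
proof (induction k arbitrary: v)
  case 0
  then show ?case using H_one by auto
next
  case (Suc k)
  then obtain g0 where g0: "g0 \<in> H" "(g0 - 1\<^sub>m n) *\<^sub>v v \<notin> V k" by auto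
  have "(g0 - 1\<^sub>m n) *\<^sub>v v \<in> carrier_vec n"
    by (rule mult_mat_vec_carrier[of _ n n]) (use H_mat[OF g0(1)] Suc.prems in auto)
  then obtain g where g: "\<And>i. g i \<in> H" "\<not> vec_in n P (iter_minus_one n g ((g0 - 1\<^sub>m n) *\<^sub>v v) k)"
    using Suc.IH g0(2) by blast
  then show ?case
    using g0(1) iter_minus_one_shift[of g0 g v k]
    by (intro exI[of _ "case_nat g0 g"]) (auto split: nat.splits simp del: iter_minus_one.simps)
qed

text \<open>Products of \<open>n\<close> factors \<open>g - 1\<close> vanish modulo
  \<open>P\<close>, so no vector escapes stage \<open>n\<close>.\<close>

lemma flag_top: "v \<in> carrier_vec n \<Longrightarrow> n \<le> k \<Longrightarrow> v \<in> V k"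
  using not_in_flag[of v n] iter_minus_one_vanishes flag_mono[of n k] by blast

text \<open>The elements \<open>g\<close> for which \<open>g - 1\<close> lowers the flag by
  \<open>k\<close> stages, like unitriangular matrices whose first \<open>k - 1\<close>
  superdiagonals are zero.\<close>

definition flag_subgroup :: "nat \<Rightarrow> 'a mat set" where
  "flag_subgroup k = {g \<in> H. \<forall>i. \<forall>v\<in>V (i + k). (g - 1\<^sub>m n) *\<^sub>v v \<in> V i}"

lemma flag_subgroupD:
  "g \<in> flag_subgroup k \<Longrightarrow> g \<in> H"
  "g \<in> flag_subgroup k \<Longrightarrow> v \<in> V (i + k) \<Longrightarrow> (g - 1\<^sub>m n) *\<^sub>v v \<in> V i"
  by (auto simp: flag_subgroup_def)

lemma flag_subgroup_1: "flag_subgroup 1 = H"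
  by (auto simp: flag_subgroup_def)

section \<open>Derived subgroups and the flag\<close>

context
  assumes H_subgroup: "subgroup H (GL n)"
begin

lemma H_inv: "g \<in> H \<Longrightarrow> inv\<^bsub>GL n\<^esub> g \<in> H"
  using subgroup.m_inv_closed[OF H_subgroup] .

lemma H_GL: "g \<in> H \<Longrightarrow> g \<in> carrier (GL n)"
  using subgroup.subset[OF H_subgroup] by blast

lemma subgroup_flag_subgroup: "subgroup (flag_subgroup k) (GL n)"
proof -
  interpret group "GL n :: 'a mat monoid" by (rule group_GL)
  show ?thesis
  proof (rule subgroupI)
    show "flag_subgroup k \<subseteq> carrier (GL n)" using flag_subgroupD(1) H_GL by blast
    have "(1\<^sub>m n - 1\<^sub>m n) *\<^sub>v v \<in> V i" if "v \<in> V (i + k)" for v i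
    proof -
      have "v \<in> carrier_vec n" using that by (rule flag_carrier)
      then have "(1\<^sub>m n - 1\<^sub>m n) *\<^sub>v v = 0\<^sub>v n" by (simp add: mult_vec_minus_one)
      moreover have "0\<^sub>v n \<in> V 0" using ring_ideal_0[OF P_ideal] by (simp add: vec_in_def)
      then have "0\<^sub>v n \<in> V i" using flag_mono[of 0 i] by blast
      ultimately show ?thesis by simp
    qed
    then have "1\<^sub>m n \<in> flag_subgroup k" using H_one by (auto simp: flag_subgroup_def)
    then show "flag_subgroup k \<noteq> {}" by blast
  next
    fix g assume g: "g \<in> flag_subgroup k"
    let ?h = "inv\<^bsub>GL n\<^esub> g"
    have gH: "g \<in> H" using g by (rule flag_subgroupD)
    have h: "?h \<in> H" using gH by (rule H_inv)
    have "(?h - 1\<^sub>m n) *\<^sub>v v \<in> V i" if v: "v \<in> V (i + k)" for v i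
    proof -
      let ?w = "?h *\<^sub>v v"
      have vc: "v \<in> carrier_vec n" using v by (rule flag_carrier)
      have w: "?w \<in> V (i + k)" using v h by (rule flag_stable)
      have wc: "?w \<in> carrier_vec n" using w by (rule flag_carrier)
      have gw: "g *\<^sub>v ?w = v"
        using assoc_mult_mat_vec[OF H_mat[OF gH] H_mat[OF h] vc] GL_inv(4)[OF H_GL[OF gH]] vc by simp
      have d: "v - ?w \<in> V i"
        using flag_subgroupD(2)[OF g w] by (simp add: mult_vec_minus_one[OF H_mat[OF gH] wc] gw)
      \<comment> \<open>This is \<open>?w - v\<close>, written with differences only, as the flag is
        known to be closed under these.\<close>
      have "(v - ?w) - (v - ?w) - (v - ?w) \<in> V i"
        by (rule flag_minus[OF flag_minus[OF d d] d])
      moreover have "(v - ?w) - (v - ?w) - (v - ?w) = (?h - 1\<^sub>m n) *\<^sub>v v"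
        unfolding mult_vec_minus_one[OF H_mat[OF h] vc]
        using vc wc H_mat[OF h] by (intro eq_vecI) auto
      ultimately show ?thesis by simp
    qed
    then show "inv\<^bsub>GL n\<^esub> g \<in> flag_subgroup k" using h by (auto simp: flag_subgroup_def)
  next
    fix g h assume g: "g \<in> flag_subgroup k" and h: "h \<in> flag_subgroup k"
    have gH: "g \<in> H" and hH: "h \<in> H" using g h by (auto dest: flag_subgroupD)
    have "(g * h - 1\<^sub>m n) *\<^sub>v v \<in> V i" if v: "v \<in> V (i + k)" for v i
    proof -
      have vc: "v \<in> carrier_vec n" using v by (rule flag_carrier)
      have hv: "h *\<^sub>v v \<in> carrier_vec n" "g *\<^sub>v (h *\<^sub>v v) \<in> carrier_vec n"
        using vc H_mat[OF hH] H_mat[OF gH] by (auto intro!: mult_mat_vec_carrier[of _ n n])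
      \<comment> \<open>From \<open>g h - 1 = (g - 1) h + (h - 1)\<close>.\<close>
      have "(g - 1\<^sub>m n) *\<^sub>v (h *\<^sub>v v) + (h - 1\<^sub>m n) *\<^sub>v v \<in> V i"
        by (intro flag_add flag_subgroupD(2)[OF g] flag_subgroupD(2)[OF h] flag_stable v hH)
      moreover have "(g - 1\<^sub>m n) *\<^sub>v (h *\<^sub>v v) + (h - 1\<^sub>m n) *\<^sub>v v = (g * h - 1\<^sub>m n) *\<^sub>v v"
        unfolding mult_vec_minus_one[OF H_mat[OF gH] hv(1)] mult_vec_minus_one[OF H_mat[OF hH] vc]
          mult_vec_minus_one[OF H_mat[OF H_mult[OF gH hH]] vc]
          assoc_mult_mat_vec[OF H_mat[OF gH] H_mat[OF hH] vc]
        using vc hv H_mat[OF gH] H_mat[OF hH] by (intro eq_vecI) auto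
      ultimately show ?thesis by simp
    qed
    then show "g \<otimes>\<^bsub>GL n\<^esub> h \<in> flag_subgroup k"
      using H_mult[OF gH hH] by (auto simp: flag_subgroup_def GL_simps)
  qed
qed

text \<open>For the commutator \<open>c\<close> and
  \<open>w = g\<^sup>-\<^sup>1 h\<^sup>-\<^sup>1 v\<close> one has
  \<open>(c - 1) v = (g h - h g) w\<close>. Its expansion applies two factors in turn, each lowering
  the flag by \<open>k\<close> stages.\<close>

lemma commutator_flag_subgroup:
  assumes g: "g \<in> flag_subgroup k" and h: "h \<in> flag_subgroup k"
  shows "g * h * inv\<^bsub>GL n\<^esub> g * inv\<^bsub>GL n\<^esub> h \<in> flag_subgroup (2 * k)"
proof -
  let ?g = "inv\<^bsub>GL n\<^esub> g" and ?h = "inv\<^bsub>GL n\<^esub> h"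
  let ?c = "g * h * ?g * ?h"
  have gH: "g \<in> H" and hH: "h \<in> H" using g h by (auto dest: flag_subgroupD)
  have iH: "?g \<in> H" "?h \<in> H" using gH hH by (auto intro: H_inv)
  note inv = GL_inv[OF H_GL[OF gH]] GL_inv[OF H_GL[OF hH]]
  have cH: "?c \<in> H" by (intro H_mult gH hH iH)
  note c = H_mat[OF gH] H_mat[OF hH] H_mat[OF iH(1)] H_mat[OF iH(2)] H_mat[OF cH]
  have "(?c - 1\<^sub>m n) *\<^sub>v v \<in> V i" if v: "v \<in> V (i + 2 * k)" for v i
  proof -
    define w where "w = ?g *\<^sub>v (?h *\<^sub>v v)"
    have vc: "v \<in> carrier_vec n" using v by (rule flag_carrier)
    have w: "w \<in> V ((i + k) + k)" unfolding w_def
      using flag_stable[OF flag_stable[OF v iH(2)] iH(1)] by (simp add: mult_2 add.assoc)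
    have wc: "w \<in> carrier_vec n" using w by (rule flag_carrier)
    have hv: "?h *\<^sub>v v \<in> carrier_vec n" using c vc by (auto intro!: mult_mat_vec_carrier[of _ n n])
    have gw: "g *\<^sub>v w = ?h *\<^sub>v v"
      unfolding w_def assoc_mult_mat_vec[OF c(1,3) hv, symmetric] inv(4) using hv by simp
    have hgw: "(h * g) *\<^sub>v w = v"
      unfolding assoc_mult_mat_vec[OF c(2,1) wc] gw
      unfolding assoc_mult_mat_vec[OF c(2,4) vc, symmetric] inv(8) using vc by simp
    have gh: "g * h \<in> carrier_mat n n" "h * g \<in> carrier_mat n n" "g * h * ?g \<in> carrier_mat n n"
      using c by auto
    have "(?c - 1\<^sub>m n) *\<^sub>v v = (g * h) *\<^sub>v w - (h * g) *\<^sub>v w"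
      unfolding mult_vec_minus_one[OF c(5) vc] hgw
      unfolding assoc_mult_mat_vec[OF gh(3) c(4) vc] assoc_mult_mat_vec[OF gh(1) c(3) hv] w_def ..
    also have "\<dots> = (g * h - h * g) *\<^sub>v w"
      using minus_mult_distrib_mat_vec[OF gh(1,2) wc] by simp
    also have "\<dots> = (g - 1\<^sub>m n) *\<^sub>v ((h - 1\<^sub>m n) *\<^sub>v w) - (h - 1\<^sub>m n) *\<^sub>v ((g - 1\<^sub>m n) *\<^sub>v w)"
    proof -
      have d: "g - 1\<^sub>m n \<in> carrier_mat n n" "h - 1\<^sub>m n \<in> carrier_mat n n"
        "(g - 1\<^sub>m n) * (h - 1\<^sub>m n) \<in> carrier_mat n n" "(h - 1\<^sub>m n) * (g - 1\<^sub>m n) \<in> carrier_mat n n"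
        using c by auto
      show ?thesis
        unfolding commutator_expand[OF c(1,2)] minus_mult_distrib_mat_vec[OF d(3,4) wc]
          assoc_mult_mat_vec[OF d(1,2) wc] assoc_mult_mat_vec[OF d(2,1) wc] ..
    qed
    also have "\<dots> \<in> V i"
      using w by (intro flag_minus flag_subgroupD(2)[OF g] flag_subgroupD(2)[OF h])
    finally show ?thesis .
  qed
  then show ?thesis using cH by (auto simp: flag_subgroup_def)
qed

lemma derived_flag_subgroup: "(derived (GL n) ^^ k) H \<subseteq> flag_subgroup (2 ^ k)"
proof (induction k)
  case 0
  then show ?case using flag_subgroup_1 by simp
next
  case (Suc k)
  have "derived (GL n) ((derived (GL n) ^^ k) H) \<subseteq> flag_subgroup (2 * 2 ^ k)"
    by (rule derived_GL_subset[OF subgroup_flag_subgroup])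
      (use Suc commutator_flag_subgroup in blast)
  then show ?case by simp
qed

lemma flag_subgroup_top:
  assumes "n \<le> k"
  shows "flag_subgroup k \<subseteq> cong_subgroup n P"
proof
  fix g assume g: "g \<in> flag_subgroup k"
  have gH: "g \<in> H" using g by (rule flag_subgroupD)
  have "mat_cong n P g (1\<^sub>m n)"
    unfolding mat_cong_def
  proof (intro conjI allI impI)
    fix i j assume ij: "i < n" "j < n"
    have "unit_vec n j \<in> V (0 + k)" using flag_top[OF _ assms] by simp
    from flag_subgroupD(2)[OF g this]
    have "((g - 1\<^sub>m n) *\<^sub>v unit_vec n j) $ i \<in> P" using ij by (simp add: vec_in_def)
    then show "g $$ (i, j) - 1\<^sub>m n $$ (i, j) \<in> P"
      using ij H_mat[OF gH] by simp
  qed (use H_mat[OF gH] in auto)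
  then show "g \<in> cong_subgroup n P" using H_GL[OF gH] by (simp add: cong_subgroup_def)
qed

lemma derived_cong_subgroup: "(derived (GL n) ^^ n) H \<subseteq> cong_subgroup n P"
  using derived_flag_subgroup[of n] flag_subgroup_top[of "2 ^ n"] less_exp[of n] by force

end

end

section \<open>Groups with dense torsion\<close>

text \<open>Density of the torsion elements is expressed as approximation modulo each
  \<open>M k\<close>.\<close>

locale torsion_dense = complete_local M p
  for M :: "nat \<Rightarrow> 'a::comm_ring_1 set" and p :: nat +
  fixes n :: nat and G D :: "'a mat set"
  assumes G_subgroup: "subgroup G (GL n)"
    and D_subset: "D \<subseteq> G"
    and D_torsion: "d \<in> D \<Longrightarrow> \<exists>k>0. d ^\<^sub>m k = 1\<^sub>m n"
    and D_dense: "g \<in> G \<Longrightarrow> \<exists>d\<in>D. mat_cong n (M k) d g"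
begin

lemma G_carrier: "g \<in> G \<Longrightarrow> g \<in> carrier (GL n)"
  using subgroup.subset[OF G_subgroup] by blast

lemma G_mat: "g \<in> G \<Longrightarrow> g \<in> carrier_mat n n"
  using G_carrier GL_carrierD by blast

text \<open>The groups \<open>U\<^sub>j\<close> of the introduction.\<close>

definition cong_part :: "nat \<Rightarrow> 'a mat set" where
  "cong_part j = G \<inter> cong_subgroup n (M j)"

lemma subgroup_cong_part: "subgroup (cong_part j) (GL n)"
  unfolding cong_part_def
  by (intro group.subgroups_Inter_pair[OF group_GL] G_subgroup subgroup_cong_subgroup M_ideal)

lemma cong_part_antimono: "i \<le> j \<Longrightarrow> cong_part j \<subseteq> cong_part i"
  unfolding cong_part_def cong_subgroup_def using mat_cong_mono[OF M_antimono] by blast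

lemma cong_partD:
  assumes "g \<in> cong_part j"
  shows "g \<in> G" "g \<in> carrier (GL n)" "g \<in> carrier_mat n n" "mat_cong n (M j) g (1\<^sub>m n)"
  using assms G_carrier G_mat by (auto simp: cong_part_def cong_subgroup_def)

text \<open>Approximating modulo \<open>M (max j k)\<close> keeps the torsion element inside
  \<open>cong_part j\<close>.\<close>

lemma torsion_approximation:
  assumes g: "g \<in> cong_part j"
  obtains d where "d \<in> D" "d \<in> cong_part j" "mat_cong n (M k) g d"
proof -
  obtain d where d: "d \<in> D" "mat_cong n (M (max j k)) d g"
    using D_dense[OF cong_partD(1)[OF g]] by blast
  have dk: "mat_cong n (M k) d g" and dj: "mat_cong n (M j) d g"
    using mat_cong_mono[OF M_antimono d(2)] by auto
  have "mat_cong n (M j) d (1\<^sub>m n)"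
    by (rule mat_cong_trans[OF M_ideal dj cong_partD(4)[OF g]])
  then have "d \<in> cong_part j"
    using d(1) D_subset G_carrier by (auto simp: cong_part_def cong_subgroup_def)
  then show ?thesis using that d(1) mat_cong_sym[OF M_ideal dk] by blast
qed

text \<open>Primes are stripped off the exponent one at a time: for \<open>m = r * q\<close>, the
  matrix \<open>g ^\<^sub>m r\<close> has trivial \<open>q\<close>-th power modulo \<open>P\<close>,
  so it is itself trivial by \<open>torsion_cong_one\<close>.\<close>

lemma coprime_torsion_cong_one:
  assumes P: "ring_prime_ideal P" and "0 < m"
    and q: "\<And>q. prime q \<Longrightarrow> q dvd m \<Longrightarrow> of_nat q ^ n \<notin> ideal_add P (M j)"
    and "mat_cong n (M j) g (1\<^sub>m n)" "mat_cong n P (g ^\<^sub>m m) (1\<^sub>m n)"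
  shows "mat_cong n P g (1\<^sub>m n)"
  using assms(2-)
proof (induction m rule: less_induct)
  case (less m)
  have gc: "g \<in> carrier_mat n n" using less.prems(3) by (rule mat_congD)
  show ?case
  proof (cases "m = 1")
    case True
    then show ?thesis using less.prems(4) gc by simp
  next
    case False
    then obtain q where q: "prime q" "q dvd m" using prime_factor_nat by blast
    then obtain r where r: "m = r * q" by (auto simp: dvd_def mult.commute)
    have qn: "of_nat q ^ n \<notin> ideal_add P (M j)" using less.prems(2) q by blast
    have "mat_cong n (M j) (g ^\<^sub>m r) (1\<^sub>m n)"
      using mat_cong_pow[OF M_ideal less.prems(3), of r] by (simp add: one_pow_mat)
    moreover have "mat_cong n P ((g ^\<^sub>m r) ^\<^sub>m q) (1\<^sub>m n)"
      using less.prems(4) by (simp add: pow_mat_mult[OF gc] r)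
    ultimately have "mat_cong n P (g ^\<^sub>m r) (1\<^sub>m n)"
      by (rule torsion_cong_one[OF P M_ideal qn])
    moreover have "0 < r" "r < m" using less.prems(1) r prime_gt_1_nat[OF q(1)] by auto
    ultimately show ?thesis
      using less.IH[of r] less.prems(2,3) r by auto
  qed
qed

lemma prime_ideal_le:
  assumes "ring_prime_ideal P" "1 \<le> j"
  shows "ideal_add P (M j) \<subseteq> M 1"
proof -
  have "P \<subseteq> M 1"
    by (intro proper_ideal_le ring_prime_ideal_ideal[OF assms(1)] ring_prime_ideal_one[OF assms(1)])
  then show ?thesis
    using M_antimono[OF assms(2)] ring_ideal_add[OF M_ideal] unfolding ideal_add_def by blast
qed

lemma coprime_prime_notin:
  assumes "ring_prime_ideal P" "1 \<le> j" "prime q" "q \<noteq> p"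
  shows "of_nat q ^ n \<notin> ideal_add P (M j)"
proof
  assume "of_nat q ^ n \<in> ideal_add P (M j)"
  then have "of_nat q \<in> M 1" using prime_ideal_le[OF assms(1,2)] M1_power by blast
  then have "p dvd q" using characteristic by simp
  then show False using assms(3,4) prime_p primes_dvd_imp_eq by blast
qed

text \<open>As \<open>P\<close> is closed, some \<open>P + M j\<close> omits \<open>p ^ n\<close>,
  and it omits \<open>q ^ n\<close> for the other primes \<open>q\<close> once
  \<open>j \<ge> 1\<close>. Torsion in \<open>cong_part j\<close> is then trivial modulo
  \<open>P\<close>; density and closedness extend this to all of it.\<close>

lemma cong_part_trivial_mod_prime:
  assumes P: "ring_prime_ideal P" and pP: "of_nat p \<notin> P"
  shows "\<exists>j. cong_part j \<subseteq> cong_subgroup n P"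
proof -
  note PI = ring_prime_ideal_ideal[OF P]
  have "of_nat p ^ n \<notin> P" using pP ring_prime_ideal_power[OF P] by blast
  then obtain j0 where j0: "of_nat p ^ n \<notin> ideal_add P (M j0)" using ideal_closed[OF PI] by blast
  define j where "j = max 1 j0"
  have pj: "of_nat p ^ n \<notin> ideal_add P (M j)"
    using j0 M_antimono[of j0 j] unfolding ideal_add_def j_def by fastforce
  have "mat_cong n P g (1\<^sub>m n)" if g: "g \<in> cong_part j" for g
    unfolding mat_cong_def
  proof (intro conjI allI impI)
    fix i l assume il: "i < n" "l < n"
    show "g $$ (i, l) - 1\<^sub>m n $$ (i, l) \<in> P"
    proof (rule ideal_closed[OF PI])
      fix k
      obtain d where d: "d \<in> D" "d \<in> cong_part j" "mat_cong n (M k) g d"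
        using torsion_approximation[OF g] .
      obtain m where m: "0 < m" "d ^\<^sub>m m = 1\<^sub>m n" using D_torsion[OF d(1)] by blast
      have "mat_cong n P d (1\<^sub>m n)"
      proof (rule coprime_torsion_cong_one[OF P m(1) _ cong_partD(4)[OF d(2)]])
        show "of_nat q ^ n \<notin> ideal_add P (M j)" if "prime q" "q dvd m" for q
          using pj coprime_prime_notin[OF P _ that(1)] by (cases "q = p") (auto simp: j_def)
      qed (simp add: m(2) mat_cong_refl[OF PI])
      then have "d $$ (i, l) - 1\<^sub>m n $$ (i, l) \<in> P" using il by (rule mat_congD)
      moreover have "(g $$ (i, l) - 1\<^sub>m n $$ (i, l)) - (d $$ (i, l) - 1\<^sub>m n $$ (i, l)) \<in> M k"
        using mat_congD(3)[OF d(3) il] by simp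
      ultimately show "g $$ (i, l) - 1\<^sub>m n $$ (i, l) \<in> ideal_add P (M k)"
        by (rule ideal_add_minusI[OF M_ideal])
    qed
  qed (use cong_partD(3)[OF g] in auto)
  then have "cong_part j \<subseteq> cong_subgroup n P"
    using cong_partD(2) by (auto simp: cong_subgroup_def)
  then show ?thesis by blast
qed

text \<open>For a torsion element \<open>d\<close> of order dividing \<open>p ^ e * r\<close>, with
  \<open>r\<close> prime to \<open>p\<close>, already \<open>d ^\<^sub>m (p ^ e)\<close> is trivial
  modulo \<open>P\<close>. The determinant congruence then holds up to a \<open>p\<close>-power
  exponent, which the prime \<open>P\<close> removes.\<close>

lemma det_cong_part_char_p:
  assumes P: "ring_prime_ideal P" and pP: "of_nat p \<in> P" and g: "g \<in> cong_part 1"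
  shows "det (1\<^sub>m n - a \<cdot>\<^sub>m g) - (1 - a) ^ n \<in> P"
proof (rule ideal_closed[OF ring_prime_ideal_ideal[OF P]])
  fix k
  note PI = ring_prime_ideal_ideal[OF P]
  obtain d where d: "d \<in> D" "d \<in> cong_part 1" "mat_cong n (M k) g d"
    using torsion_approximation[OF g] .
  obtain m where m: "0 < m" "d ^\<^sub>m m = 1\<^sub>m n" using D_torsion[OF d(1)] by blast
  obtain e r where er: "m = p ^ e * r" "\<not> p dvd r"
    using multiplicity_decompose'[of m p] m(1) prime_p by (metis not_prime_unit less_numeral_extra(3))
  note dc = cong_partD(3)[OF d(2)]
  have "mat_cong n P (d ^\<^sub>m (p ^ e)) (1\<^sub>m n)"
  proof (rule coprime_torsion_cong_one[OF P, of r])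
    show "0 < r" using er m(1) by (cases r) auto
    show "of_nat q ^ n \<notin> ideal_add P (M 1)" if "prime q" "q dvd r" for q
      using coprime_prime_notin[OF P _ that(1)] that(2) er(2) by auto
    show "mat_cong n (M 1) (d ^\<^sub>m (p ^ e)) (1\<^sub>m n)"
      using mat_cong_pow[OF M_ideal cong_partD(4)[OF d(2)], of "p ^ e"] by (simp add: one_pow_mat)
    show "mat_cong n P ((d ^\<^sub>m (p ^ e)) ^\<^sub>m r) (1\<^sub>m n)"
      using m(2) by (simp add: pow_mat_mult[OF dc] er(1) mat_cong_refl[OF PI])
  qed
  from det_one_minus_power_cong[OF prime_p PI pP dc this, of a]
  have 1: "det (1\<^sub>m n - a \<cdot>\<^sub>m d) - (1 - a) ^ n \<in> P" by (rule ring_prime_ideal_power[OF P])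
  have "mat_cong n (M k) (1\<^sub>m n - a \<cdot>\<^sub>m g) (1\<^sub>m n - a \<cdot>\<^sub>m d)"
    by (intro mat_cong_minus mat_cong_smult mat_cong_refl M_ideal d) (auto simp: ring_ideal_0[OF M_ideal])
  from det_cong[OF M_ideal this]
  have "(det (1\<^sub>m n - a \<cdot>\<^sub>m g) - (1 - a) ^ n) - (det (1\<^sub>m n - a \<cdot>\<^sub>m d) - (1 - a) ^ n) \<in> M k" by simp
  with 1 show "det (1\<^sub>m n - a \<cdot>\<^sub>m g) - (1 - a) ^ n \<in> ideal_add P (M k)"
    by (intro ideal_add_minusI[OF M_ideal])
qed

text \<open>The good ideals of the introduction; both \<open>j\<close> and \<open>N\<close> may
  depend on \<open>I\<close>.\<close>

definition solvable_mod :: "'a set \<Rightarrow> bool" where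
  "solvable_mod I \<longleftrightarrow> (\<exists>j N. (derived (GL n) ^^ N) (cong_part j) \<subseteq> cong_subgroup n I)"

lemma solvable_mod_prime:
  assumes P: "ring_prime_ideal P"
  shows "solvable_mod P"
proof (cases "of_nat p \<in> P")
  case False
  then obtain j where "cong_part j \<subseteq> cong_subgroup n P"
    using cong_part_trivial_mod_prime[OF P] by blast
  then show ?thesis
    unfolding solvable_mod_def by (intro exI[of _ j] exI[of _ 0]) simp
next
  case pP: True
  show ?thesis
  \<comment> \<open>The unipotent argument requires an element \<open>t\<close> of
    \<open>M 1\<close> outside \<open>P\<close>; if there is none, \<open>cong_part 1\<close> is
    already trivial modulo \<open>P\<close>.\<close>
  proof (cases "M 1 \<subseteq> P")
    case True
    then have "cong_part 1 \<subseteq> cong_subgroup n P"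
      using mat_cong_mono by (auto simp: cong_part_def cong_subgroup_def)
    then show ?thesis
      unfolding solvable_mod_def by (intro exI[of _ 1] exI[of _ 0]) simp
  next
    case False
    then obtain t where t: "t \<in> M 1" "t \<notin> P" by blast
    interpret U: unipotent_mod_prime M p n "cong_part 1" P t
    proof unfold_locales
      show "cong_part 1 \<subseteq> carrier_mat n n" using cong_partD(3) by blast
      show "1\<^sub>m n \<in> cong_part 1"
        using subgroup.one_closed[OF subgroup_cong_part, of 1] by (simp add: GL_simps)
      show "g * h \<in> cong_part 1" if "g \<in> cong_part 1" "h \<in> cong_part 1" for g h
        using subgroup.m_closed[OF subgroup_cong_part that] by (simp add: GL_simps)
    qed (use P t det_cong_part_char_p[OF P pP] in auto)
    show ?thesis
      unfolding solvable_mod_def using U.derived_cong_subgroup[OF subgroup_cong_part] by blast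
  qed
qed

lemma solvable_mod_ideal:
  assumes "ring_ideal I"
  shows "solvable_mod I"
proof (rule noetherian_induct[where Q = solvable_mod])
  show "solvable_mod UNIV"
    unfolding solvable_mod_def
    using cong_partD(2,3) by (intro exI[of _ 0]) (auto simp: cong_subgroup_def mat_cong_UNIV)
next
  fix I I1 I2
  assume I: "ring_ideal I" "ring_ideal I1" "ring_ideal I2" and S: "solvable_mod I1" "solvable_mod I2"
    and mult: "\<And>x y. x \<in> I1 \<Longrightarrow> y \<in> I2 \<Longrightarrow> x * y \<in> I"
  obtain j1 N1 j2 N2 where 1: "(derived (GL n) ^^ N1) (cong_part j1) \<subseteq> cong_subgroup n I1"
    and 2: "(derived (GL n) ^^ N2) (cong_part j2) \<subseteq> cong_subgroup n I2"
    using S unfolding solvable_mod_def by blast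
  \<comment> \<open>Larger \<open>j\<close> and \<open>N\<close> only shrink the derived subgroups,
    so one pair serves both ideals.\<close>
  define j N where "j = max j1 j2" and "N = max N1 N2"
  have sub: "(derived (GL n) ^^ N) (cong_part j) \<subseteq> (derived (GL n) ^^ N') (cong_part j')"
    if "N' \<le> N" "j' \<le> j" for N' j'
    using derived_power_antimono[OF subgroup_cong_part that(1), of j]
      group.mono_exp_of_derived[OF group_GL cong_part_antimono[OF that(2)], of N' n] by blast
  have "derived (GL n) ((derived (GL n) ^^ N) (cong_part j)) \<subseteq> cong_subgroup n I"
    by (rule derived_product_ideal[OF I mult])
      (use sub[of N1 j1] sub[of N2 j2] 1 2 in \<open>auto simp: j_def N_def\<close>)
  then show "solvable_mod I"
    unfolding solvable_mod_def by (intro exI[of _ j] exI[of _ "Suc N"]) simp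
qed (use assms solvable_mod_prime in auto)

lemma solvable_cong_part: "\<exists>j. solvable (GL n\<lparr>carrier := cong_part j\<rparr>)"
proof -
  obtain j N where jN: "(derived (GL n) ^^ N) (cong_part j) \<subseteq> cong_subgroup n {0}"
    using solvable_mod_ideal[OF ring_ideal_zero] unfolding solvable_mod_def by blast
  let ?H = "cong_part j"
  let ?K = "GL n\<lparr>carrier := ?H\<rparr>"
  interpret GLn: group "GL n :: 'a mat monoid" by (rule group_GL)
  interpret K: group ?K by (rule GLn.subgroup_imp_group[OF subgroup_cong_part])
  have sub: "(derived (GL n) ^^ k) ?H \<subseteq> ?H" for k
    using derived_power_antimono[OF subgroup_cong_part, of 0 k] by simp
  have eq: "(derived ?K ^^ k) ?H = (derived (GL n) ^^ k) ?H" for k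
    by (induction k) (simp_all add: GLn.derived_consistent[OF sub subgroup_cong_part])
  have "cong_subgroup n {0} \<subseteq> {1\<^sub>m n :: 'a mat}"
    by (auto simp: cong_subgroup_def mat_cong_def intro!: eq_matI)
  moreover have "1\<^sub>m n \<in> (derived (GL n) ^^ N) ?H"
    using subgroup.one_closed[OF GLn.exp_of_derived_is_subgroup[OF subgroup_cong_part]]
    by (simp add: GL_simps)
  ultimately have "(derived ?K ^^ N) ?H = {\<one>\<^bsub>?K\<^esub>}" using eq[of N] jN by (auto simp: GL_simps)
  then have "solvable ?K" using K.solvable_iff_trivial_derived_seq by auto
  then show ?thesis by blast
qed

text \<open>The coset of a matrix is determined by the residues of its entries modulo
  \<open>M j\<close>, for which there are finitely many choices; \<open>code\<close> records
  them.\<close>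

lemma finite_rcosets_cong_part: "finite (rcosets\<^bsub>GL n\<lparr>carrier := G\<rparr>\<^esub> (cong_part j))"
proof -
  interpret GLn: group "GL n :: 'a mat monoid" by (rule group_GL)
  let ?K = "GL n\<lparr>carrier := G\<rparr>"
  interpret K: group ?K by (rule GLn.subgroup_imp_group[OF G_subgroup])
  have H: "subgroup (cong_part j) ?K"
    by (rule GLn.subgroup_incl[OF subgroup_cong_part G_subgroup]) (auto simp: cong_part_def)
  obtain R where R: "finite R" "\<And>x. \<exists>r\<in>R. x - r \<in> M j" using finite_quotient by blast
  obtain r where r: "\<And>x. r x \<in> R" "\<And>x. x - r x \<in> M j" using R(2) unfolding Bex_def by metis
  define code where "code g = (\<lambda>ij\<in>{..<n} \<times> {..<n}. r (g $$ ij))" for g :: "'a mat"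
  have fin: "finite (code ` G)"
  proof (rule finite_subset)
    show "code ` G \<subseteq> ({..<n} \<times> {..<n}) \<rightarrow>\<^sub>E R"
      unfolding code_def by (intro image_subsetI restrict_PiE_iff[THEN iffD2] ballI r(1))
  qed (use R(1) in \<open>auto intro!: finite_PiE\<close>)
  have coset: "cong_part j #>\<^bsub>?K\<^esub> a = cong_part j #>\<^bsub>?K\<^esub> b"
    if a: "a \<in> G" and b: "b \<in> G" and ab: "code a = code b" for a b
  proof -
    have "mat_cong n (M j) a b"
      unfolding mat_cong_def
    proof (intro conjI allI impI)
      fix i k assume "i < n" "k < n"
      then have "r (a $$ (i, k)) = r (b $$ (i, k))"
        using fun_cong[OF ab, of "(i, k)"] by (simp add: code_def)
      then show "a $$ (i, k) - b $$ (i, k) \<in> M j"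
        using ring_ideal_minus[OF M_ideal r(2)[of "a $$ (i, k)"] r(2)[of "b $$ (i, k)"]] by simp
    qed (use G_mat a b in auto)
    note bG = G_carrier[OF b] and aG = G_carrier[OF a]
    let ?b = "inv\<^bsub>GL n\<^esub> b"
    have "mat_cong n (M j) (a * ?b) (b * ?b)"
      by (intro mat_cong_mult mat_cong_refl M_ideal GL_inv(2)[OF bG]) fact
    then have "mat_cong n (M j) (a * ?b) (1\<^sub>m n)" using GL_inv(4)[OF bG] by simp
    moreover have "a * ?b \<in> G"
      using subgroup.m_closed[OF G_subgroup a subgroup.m_inv_closed[OF G_subgroup b]]
      by (simp add: GL_simps)
    ultimately have "a * ?b \<in> cong_part j"
      using G_carrier by (simp add: cong_part_def cong_subgroup_def)
    moreover have "(a * ?b) * b = a"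
      using GL_inv[OF bG] GL_carrierD[OF aG] GL_carrierD[OF bG]
      by (simp add: assoc_mult_mat[of _ n n _ n _ n])
    ultimately have "a \<in> cong_part j #>\<^bsub>?K\<^esub> b"
      unfolding r_coset_def by (intro UN_I[of "a * ?b"]) (simp_all add: GL_simps del: assoc_mult_mat)
    then show ?thesis using K.repr_independence[OF _ _ H] b by simp
  qed
  have "rcosets\<^bsub>?K\<^esub> (cong_part j) \<subseteq> (\<lambda>c. cong_part j #>\<^bsub>?K\<^esub> (SOME a. a \<in> G \<and> code a = c)) ` code ` G"
  proof
    fix X assume "X \<in> rcosets\<^bsub>?K\<^esub> (cong_part j)"
    then obtain a where a: "a \<in> G" "X = cong_part j #>\<^bsub>?K\<^esub> a" by (auto simp: RCOSETS_def)
    define b where "b = (SOME b. b \<in> G \<and> code b = code a)"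
    have "b \<in> G \<and> code b = code a" unfolding b_def by (rule someI[of _ a]) (use a in simp)
    then have "X = cong_part j #>\<^bsub>?K\<^esub> b" using coset a by metis
    then show "X \<in> (\<lambda>c. cong_part j #>\<^bsub>?K\<^esub> (SOME a. a \<in> G \<and> code a = c)) ` code ` G"
      unfolding b_def using a(1) by blast
  qed
  then show ?thesis using fin by (meson finite_imageI finite_subset)
qed

lemma virtually_solvable:
  "\<exists>H. subgroup H (GL n\<lparr>carrier := G\<rparr>) \<and> solvable (GL n\<lparr>carrier := H\<rparr>) \<and>
     finite (rcosets\<^bsub>GL n\<lparr>carrier := G\<rparr>\<^esub> H)"
proof -
  obtain j where "solvable (GL n\<lparr>carrier := cong_part j\<rparr>)" using solvable_cong_part by blast
  moreover have "subgroup (cong_part j) (GL n\<lparr>carrier := G\<rparr>)"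
    by (rule group.subgroup_incl[OF group_GL subgroup_cong_part G_subgroup]) (auto simp: cong_part_def)
  ultimately show ?thesis using finite_rcosets_cong_part by blast
qed

end

section \<open>Pro-p rings as complete local rings\<close>

lemma ideal_class_ring_iff: "ideal I (class_ring :: 'a::comm_ring_1 ring) \<longleftrightarrow> ring_ideal I"
proof
  let ?R = "class_ring :: 'a ring"
  assume "ideal I ?R"
  then interpret ideal I ?R .
  show "ring_ideal I"
    unfolding ring_ideal_def
    using additive_subgroup.zero_closed[OF additive_subgroup_axioms]
      additive_subgroup.a_closed[OF additive_subgroup_axioms] I_l_closed
    by (auto simp: class_ring_simps)
next
  let ?R = "class_ring :: 'a ring"
  assume I: "ring_ideal I"
  show "ideal I ?R"
  proof (rule idealI)
    show "ring ?R" by (rule class_ring.ring_axioms)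
    show "subgroup I (add_monoid ?R)"
    proof (rule group.subgroupI)
      show "group (add_monoid ?R)"
        by (rule abelian_group.a_group[OF ring.is_abelian_group[OF class_ring.ring_axioms]])
      show "inv\<^bsub>add_monoid ?R\<^esub> x \<in> I" if "x \<in> I" for x
        using ring_ideal_uminus[OF I that] class_ring_simps(8)[where 'a = 'a]
        by (simp add: a_inv_def fun_eq_iff)
    qed (use I ring_ideal_0 ring_ideal_add in auto)
  qed (use I ring_ideal_mult_left ring_ideal_mult_right in auto)
qed

lemma genideal_class_ring: "genideal (class_ring :: 'a::comm_ring_1 ring) A = ideal_gen A"
  by (simp add: genideal_def ideal_gen_def ideal_class_ring_iff)

lemma complete_local_pro_p_ring:
  assumes pro_p: "pro_p_ring (class_ring :: 'a::comm_ring_1 ring) p"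
  shows "complete_local (ideal_power (class_ring :: 'a ring) (max_ideal class_ring)) p"
proof -
  let ?R = "class_ring :: 'a ring"
  define m where "m = max_ideal ?R"
  let ?M = "ideal_power ?R m"
  have "\<exists>!I. maximalideal I ?R" using pro_p by (simp add: pro_p_ring_def local_ring_def)
  then have "maximalideal m ?R" unfolding m_def max_ideal_def by (rule theI')
  then interpret m: maximalideal m ?R .
  have mI: "ring_ideal m" using m.ideal_axioms by (simp add: ideal_class_ring_iff)
  have MI: "ring_ideal (?M k)" for k
    using ideal_ideal_power[OF class_ring.ring_axioms m.ideal_axioms] by (simp add: ideal_class_ring_iff)
  \<comment> \<open>\<open>ideal_power\<close> starts from the whole ring, so the first power is a
    product of \<open>m\<close> with the ring.\<close>
  have M1: "?M 1 = m"
  proof -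
    have "x \<in> m" if "x \<in> ideal_prod ?R m UNIV" for x
      using that by (induction rule: ideal_prod.induct)
        (auto simp: ring_ideal_mult_right[OF mI] ring_ideal_add[OF mI])
    moreover have "x \<in> ideal_prod ?R m UNIV" if "x \<in> m" for x
      using ideal_prod.prod[OF that, of 1 UNIV ?R] by simp
    ultimately show ?thesis by auto
  qed
  have coset: "m +>\<^bsub>?R\<^esub> x = {h + x | h. h \<in> m}" for x
    by (auto simp: a_r_coset_def r_coset_def)
  have "complete_local ?M p"
  proof
    show "ring_ideal (?M k)" for k by (rule MI)
    show "?M 0 = UNIV" by simp
    show "x * y \<in> ?M (i + j)" if "x \<in> ?M i" "y \<in> ?M j" for x y i j
      using that(1)
    proof (induction i arbitrary: x)
      case 0
      then show ?case using ring_ideal_mult_left[OF MI that(2)] by simp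
    next
      case (Suc i)
      from Suc.prems have "x \<in> ideal_prod ?R m (?M i)" by simp
      then show ?case
      proof (induction rule: ideal_prod.induct)
        case (prod a b)
        show ?case using ideal_prod.prod[OF prod(1) Suc.IH[OF prod(2)], of ?R] by (simp add: mult.assoc)
      next
        case (sum a b)
        then show ?case using ring_ideal_add[OF MI, of "a * y" "Suc i + j" "b * y"]
          by (simp add: distrib_right)
      qed
    qed
    show "?M (Suc k) \<subseteq> ?M k" for k
      using ideal_power_antimono[OF class_ring.ring_axioms m.ideal_axioms, of k "Suc k"] by simp
    show "1 \<notin> ?M 1"
      unfolding M1 using m.I_notcarr ring_ideal_UNIV_iff[OF mI] by auto
    show "\<exists>a. 1 - a * x \<in> ?M 1" if "x \<notin> ?M 1" for x
    proof -
      \<comment> \<open>This ideal is strictly larger than \<open>m\<close>, hence by maximality the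
        whole ring.\<close>
      let ?J = "ideal_add m {r * x | r. True}"
      have J: "ring_ideal ?J" by (intro ring_ideal_ideal_add mI ring_ideal_principal)
      have "m \<subseteq> ?J" using ideal_add_left[OF ring_ideal_principal] by blast
      then have "?J = m \<or> ?J = UNIV"
        using m.I_maximal[of ?J] J by (simp add: ideal_class_ring_iff)
      moreover have "x \<in> ?J" by (rule ideal_add_right[OF mI]) (auto intro!: exI[of _ 1])
      ultimately have "1 \<in> ?J" using that unfolding M1 by auto
      then obtain h r where "1 = h + r * x" "h \<in> m" by (auto simp: ideal_add_def)
      then have "1 - r * x \<in> m" by (metis add_diff_cancel_right')
      then show ?thesis unfolding M1 by blast
    qed
    \<comment> \<open>Existence gives completeness; uniqueness for the zero sequence gives
      separatedness.\<close>
    have compl: "\<exists>!x. \<forall>k. x - s k \<in> ?M k" if "\<And>k. s (Suc k) - s k \<in> ?M k" for s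
      using pro_p that unfolding pro_p_ring_def adically_complete_def m_def[symmetric]
      by (simp add: class_ring_simps)
    show "\<exists>x. \<forall>k. x - s k \<in> ?M k" if "\<And>k. s (Suc k) - s k \<in> ?M k" for s
      using compl[OF that] by blast
    show "x = 0" if "\<And>k. x \<in> ?M k" for x
      using compl[of "\<lambda>_. 0"] that ring_ideal_0[OF MI] by auto
    show "\<exists>A. finite A \<and> I = ideal_gen A" if "ring_ideal I" for I :: "'a set"
      using pro_p noetherian_ring.finetely_gen[of ?R I] that
      by (auto simp: pro_p_ring_def ideal_class_ring_iff genideal_class_ring)
    show "\<exists>R. finite R \<and> (\<forall>x. \<exists>r\<in>R. x - r \<in> ?M 1)"
    proof (intro exI conjI allI)
      let ?Q = "carrier (?R Quot m)"
      show "finite ((\<lambda>C. SOME x. x \<in> C) ` ?Q)"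
        using pro_p by (auto simp: pro_p_ring_def m_def)
      fix x
      let ?C = "m +>\<^bsub>?R\<^esub> x"
      have C: "?C \<in> ?Q" by (auto simp: FactRing_def A_RCOSETS_def' a_r_coset_def r_coset_def)
      have "x \<in> ?C" unfolding coset using ring_ideal_0[OF mI] by force
      then have "(SOME x. x \<in> ?C) \<in> ?C" by (rule someI)
      then obtain h where "(SOME x. x \<in> ?C) = h + x" "h \<in> m" unfolding coset by blast
      then have "x - (SOME x. x \<in> ?C) \<in> ?M 1" unfolding M1 using ring_ideal_uminus[OF mI] by simp
      then show "\<exists>r\<in>(\<lambda>C. SOME x. x \<in> C) ` ?Q. x - r \<in> ?M 1" using C by blast
    qed
    show "of_nat k \<in> ?M 1 \<longleftrightarrow> p dvd k" for k
    proof -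
      let ?Q = "?R Quot m"
      interpret Q: ring ?Q by (rule m.quotient_is_ring)
      note hom = m.rcos_ring_hom
      have add_pow: "add_pow ?Q k \<one>\<^bsub>?Q\<^esub> = m +>\<^bsub>?R\<^esub> (of_nat k)" for k :: nat
      proof (induction k)
        case 0
        have "add_pow ?Q (0 :: nat) \<one>\<^bsub>?Q\<^esub> = \<zero>\<^bsub>?Q\<^esub>" by (rule Q.add.nat_pow_0)
        also have "\<dots> = m" by (simp add: FactRing_def)
        also have "m = m +>\<^bsub>?R\<^esub> 0" by (auto simp: coset)
        finally show ?case by (simp only: of_nat_0)
      next
        case (Suc k)
        have "add_pow ?Q (Suc k) \<one>\<^bsub>?Q\<^esub> = add_pow ?Q k \<one>\<^bsub>?Q\<^esub> \<oplus>\<^bsub>?Q\<^esub> \<one>\<^bsub>?Q\<^esub>"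
          by (rule Q.add.nat_pow_Suc)
        also have "\<dots> = (m +>\<^bsub>?R\<^esub> of_nat k) \<oplus>\<^bsub>?Q\<^esub> (m +>\<^bsub>?R\<^esub> 1)"
          unfolding Suc using Ring.ring_hom_one[OF hom] by simp
        also have "\<dots> = m +>\<^bsub>?R\<^esub> (of_nat k + 1)"
          using Ring.ring_hom_add[OF hom, of "of_nat k" 1] by simp
        finally show ?case by (simp only: of_nat_Suc add.commute)
      qed
      have "add_pow ?Q k \<one>\<^bsub>?Q\<^esub> = \<zero>\<^bsub>?Q\<^esub> \<longleftrightarrow> p dvd k"
        using pro_p unfolding pro_p_ring_def has_characteristic_def m_def by blast
      moreover have "\<zero>\<^bsub>?Q\<^esub> = m" by (simp add: FactRing_def)
      moreover have "m +>\<^bsub>?R\<^esub> x = m \<longleftrightarrow> x \<in> m" for x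
      proof
        assume "m +>\<^bsub>?R\<^esub> x = m"
        then show "x \<in> m" unfolding coset using ring_ideal_0[OF mI] by force
      next
        assume x: "x \<in> m"
        have "y \<in> {h + x | h. h \<in> m}" if "y \<in> m" for y
          using ring_ideal_minus[OF mI that x] by (auto intro!: exI[of _ "y - x"])
        then show "m +>\<^bsub>?R\<^esub> x = m" unfolding coset using x ring_ideal_add[OF mI] by auto
      qed
      ultimately show ?thesis unfolding M1 add_pow by simp
    qed
  qed
  then show ?thesis unfolding m_def .
qed

text \<open>Entrywise, the condition is membership in cosets of the \<open>k\<close>-th power, which
  are open in the adic topology; there are finitely many entries, so their product is open.\<close>

lemma openin_GL_coset:
  assumes "pro_p_ring (class_ring :: 'a::comm_ring_1 ring) p" and g: "(g :: 'a mat) \<in> carrier (GL n)"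
  shows "openin (GL_topology n)
    {x \<in> carrier (GL n). mat_cong n (ideal_power class_ring (max_ideal class_ring) k) x g}"
proof -
  let ?R = "class_ring :: 'a ring"
  let ?m = "max_ideal ?R"
  let ?M = "ideal_power ?R ?m"
  interpret complete_local ?M p by (rule complete_local_pro_p_ring[OF assms(1)])
  have "\<exists>!I. maximalideal I ?R" using assms(1) by (simp add: pro_p_ring_def local_ring_def)
  then have "maximalideal ?m ?R" unfolding max_ideal_def by (rule theI')
  then have mI: "ideal ?m ?R" by (rule maximalideal.axioms)
  let ?T = "adic_topology ?R ?m"
  let ?I = "{..<n} \<times> {..<n}"
  let ?C = "\<lambda>ij. {y. y - g $$ ij \<in> ?M k}"
  have "openin ?T (?C ij)" for ij
    unfolding openin_adic_topology[OF class_ring.ring_axioms mI]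
  proof (intro conjI ballI)
    fix x assume x: "x \<in> ?C ij"
    show "\<exists>k. \<forall>y\<in>carrier ?R. y \<ominus>\<^bsub>?R\<^esub> x \<in> ?M k \<longrightarrow> y \<in> ?C ij"
      using x ring_ideal_minus_trans[OF M_ideal] by (intro exI[of _ k]) (auto simp: class_ring_simps)
  qed simp
  then have "openin (product_topology (\<lambda>_. ?T) ?I) (PiE ?I ?C)"
    by (simp add: openin_PiE)
  then have op: "openin (mat_topology ?T n)
      ((\<lambda>M. \<lambda>ij\<in>?I. M $$ ij) -` PiE ?I ?C \<inter> carrier_mat n n)"
    unfolding mat_topology_def openin_pullback_topology by blast
  have eq: "{x \<in> carrier (GL n). mat_cong n (?M k) x g} =
      ((\<lambda>M. \<lambda>ij\<in>?I. M $$ ij) -` PiE ?I ?C \<inter> carrier_mat n n) \<inter> carrier (GL n)"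
  proof (intro Set.set_eqI iffI)
    fix x assume x: "x \<in> {x \<in> carrier (GL n). mat_cong n (?M k) x g}"
    then have "(\<lambda>ij\<in>?I. x $$ ij) \<in> PiE ?I ?C"
      unfolding restrict_PiE_iff mat_cong_def by blast
    with x show "x \<in> ((\<lambda>M. \<lambda>ij\<in>?I. M $$ ij) -` PiE ?I ?C \<inter> carrier_mat n n) \<inter> carrier (GL n)"
      by (simp only: mem_Collect_eq Int_iff vimage_eq GL_carrierD simp_thms)
  next
    fix x assume x: "x \<in> ((\<lambda>M. \<lambda>ij\<in>?I. M $$ ij) -` PiE ?I ?C \<inter> carrier_mat n n) \<inter> carrier (GL n)"
    then have "\<forall>ij\<in>?I. x $$ ij \<in> ?C ij"
      unfolding Int_iff vimage_eq restrict_PiE_iff by (elim conjE)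
    with x show "x \<in> {x \<in> carrier (GL n). mat_cong n (?M k) x g}"
      using GL_carrierD[OF g] unfolding mat_cong_def by blast
  qed
  show ?thesis
    unfolding eq GL_topology_def by (rule openin_subtopology_Int[OF op])
qed

theorem theorem4p1:
  fixes p n :: nat
    and G :: "'a :: comm_ring_1 mat set"
  assumes "pro_p_ring (class_ring :: 'a ring) p"
    and "subgroup G (GL n)"
    and "closedin (GL_topology n) G"
    and "\<exists>D \<subseteq> G. (\<forall>g\<in>D. torsion_element (GL n) g) \<and>
           subtopology (GL_topology n) G closure_of D = G"
  shows "\<exists>H. subgroup H (GL n\<lparr>carrier := G\<rparr>) \<and>
           solvable (GL n\<lparr>carrier := H\<rparr>) \<and>
           finite (rcosets\<^bsub>GL n\<lparr>carrier := G\<rparr>\<^esub> H)"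
proof -
  let ?M = "ideal_power (class_ring :: 'a ring) (max_ideal class_ring)"
  interpret complete_local ?M p by (rule complete_local_pro_p_ring[OF assms(1)])
  obtain D where D: "D \<subseteq> G" "\<And>g. g \<in> D \<Longrightarrow> torsion_element (GL n) g"
    "subtopology (GL_topology n) G closure_of D = G"
    using assms(4) by blast
  interpret torsion_dense ?M p n G D
  proof
    show "\<exists>k>0. d ^\<^sub>m k = 1\<^sub>m n" if "d \<in> D" for d
      using D(2)[OF that] by (auto simp: torsion_element_def GL_pow GL_simps)
    show "\<exists>d\<in>D. mat_cong n (?M k) d g" if g: "g \<in> G" for g k
    proof -
      have gG: "g \<in> carrier (GL n)" using subgroup.subset[OF assms(2)] g by blast
      \<comment> \<open>This neighbourhood of \<open>g\<close> meets \<open>D\<close> because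
        \<open>g\<close> lies in the closure; a common point is the required approximation.\<close>
      let ?U = "{x \<in> carrier (GL n). mat_cong n (?M k) x g}"
      have op: "openin (subtopology (GL_topology n) G) (?U \<inter> G)"
        by (rule openin_subtopology_Int[OF openin_GL_coset[OF assms(1) gG]])
      have gU: "g \<in> ?U \<inter> G"
        using gG g GL_carrierD[OF gG] by (simp add: mat_cong_refl[OF M_ideal])
      have "g \<in> subtopology (GL_topology n) G closure_of D" using D(3) g by simp
      then have "\<exists>d. d \<in> D \<and> d \<in> ?U \<inter> G"
        unfolding in_closure_of using op gU by (elim conjE allE[of _ "?U \<inter> G"] impE) (rule conjI)
      then show ?thesis by auto
    qed
  qed (use assms(2) D(1) in \<open>auto simp: subgroup_def\<close>)
  show ?thesis by (rule virtually_solvable)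
qed

end
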